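(* Let $n\ge2$, $\Omega\subset\mathbb{C}^n$ open, and $K\subset\Omega$ compact. The following are equivalent: (i) every $f\in\mathcal{H}(\Omega\setminus K)$ has a (unique) extension $\tilde f\in\mathcal{H}(\Omega)$; (i') every locally constant map $g:\Omega\setminus K\to\mathbb{C}$ has an extension $\tilde g\in\mathcal{H}(\Omega)$; (ii) the restriction map $\rho:\mathcal{H}(\Omega)\to\mathcal{H}(\Omega\setminus K)$, $\rho(f)=f|_{\Omega\setminus K}$, is an isomorphism of $\mathbb{C}$-algebras; (iii) $\mathbb{C}^n\setminus K$ is connected. In this case $f(\Omega)=f(\Omega\setminus K)$ for every $f\in\mathcal{H}(\Omega)$.
   Context: $\mathcal{H}(U)$ denotes the algebra of holomorphic functions $U\to\mathbb{C}$. *)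

theory Defs
  imports "HOL-Analysis.Analysis"
begin

definition holo_on :: "(complex^'n) set \<Rightarrow> (complex^'n \<Rightarrow> complex) \<Rightarrow> bool" where
  "holo_on U f \<longleftrightarrow> (\<forall>z\<in>U. \<exists>L. (f has_derivative L) (at z) \<and>
       (\<forall>c x. L (c *s x) = c * L x))"

text \<open>The algebra H(U), represented by functions that vanish outside U.\<close>
definition Hol :: "(complex^'n) set \<Rightarrow> (complex^'n \<Rightarrow> complex) set" where
  "Hol U = {f. holo_on U f \<and> (\<forall>z. z \<notin> U \<longrightarrow> f z = 0)}"

definition restr :: "(complex^'n) set \<Rightarrow> (complex^'n \<Rightarrow> complex) \<Rightarrow> complex^'n \<Rightarrow> complex" where
  "restr S f = (\<lambda>z. if z \<in> S then f z else 0)"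

definition loc_const_on :: "(complex^'n) set \<Rightarrow> (complex^'n \<Rightarrow> complex) \<Rightarrow> bool" where
  "loc_const_on U g \<longleftrightarrow> (\<forall>z\<in>U. \<exists>e>0. \<forall>w\<in>ball z e \<inter> U. g w = g z)"

definition alg_iso :: "((complex^'n \<Rightarrow> complex) \<Rightarrow> (complex^'n \<Rightarrow> complex)) \<Rightarrow>
    (complex^'n) set \<Rightarrow> (complex^'n) set \<Rightarrow> bool" where
  "alg_iso \<rho> A B \<longleftrightarrow> bij_betw \<rho> (Hol A) (Hol B) \<and>
     (\<forall>f\<in>Hol A. \<forall>g\<in>Hol A. \<rho> (\<lambda>z. f z + g z) = (\<lambda>z. \<rho> f z + \<rho> g z)
                         \<and> \<rho> (\<lambda>z. f z * g z) = (\<lambda>z. \<rho> f z * \<rho> g z)) \<and>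
     (\<forall>f\<in>Hol A. \<forall>c::complex. \<rho> (\<lambda>z. c * f z) = (\<lambda>z. c * \<rho> f z)) \<and>
     \<rho> (restr A (\<lambda>_. 1)) = restr B (\<lambda>_. 1)"

end

theory Submission
  imports Defs "HOL-Complex_Analysis.Complex_Analysis"
begin

text \<open>
  Hartogs extension: fix a coordinate \<open>i\<close> and, for every point \<open>z\<close>, form the Cauchy integral of
  \<open>f\<close> in the \<open>i\<close>-th variable over a cycle in the slice of \<open>\<Omega> - K\<close> through \<open>z\<close> that surrounds the slice
  of \<open>K\<close> and the point itself. By Cauchy's theorem the cycle can be kept fixed while \<open>z\<close> varies a little,
  so this is holomorphic on \<open>\<Omega>\<close>. Its difference to \<open>f\<close> is the integral over a cycle that surrounds
  only the slice of \<open>K\<close>; that integral is defined and holomorphic on all of \<open>- K\<close> and vanishes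
  when another coordinate is large, because the slice of \<open>K\<close> is then empty. If \<open>- K\<close> is connected it vanishes
  identically. To avoid constructing cycles, contour integrals are replaced by area integrals
  against the gradient of a cutoff function. Conversely, a bounded component \<open>W\<close> of \<open>- K\<close> yields the locally
  constant function \<open>1\<close> on \<open>W\<close> and \<open>0\<close> elsewhere, whose extension would be a nonzero holomorphic
  function with bounded support on the whole space.
\<close>

subsection \<open>Integrals of compactly supported derivatives\<close>

lemma has_integral_compact_support:
  fixes h :: "'a::euclidean_space \<Rightarrow> 'b::banach"
  assumes "continuous_on UNIV h" "\<And>x. x \<notin> S \<Longrightarrow> h x = 0" "S \<subseteq> cbox a b"
  shows "(h has_integral integral (cbox a b) h) UNIV"
proof -
  have "(h has_integral integral (cbox a b) h) (cbox a b)"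
    using integrable_integral[OF integrable_continuous[OF continuous_on_subset[OF assms(1)]]] by blast
  then show ?thesis
    by (rule has_integral_on_superset) (use assms in auto)
qed

lemma integrable_compact_support:
  fixes h :: "'a::euclidean_space \<Rightarrow> 'b::banach"
  assumes "continuous_on UNIV h" "compact S" "\<And>x. x \<notin> S \<Longrightarrow> h x = 0"
  shows "h integrable_on UNIV"
proof -
  obtain a b where "S \<subseteq> cbox a b"
    using bounded_subset_cbox_symmetric[OF compact_imp_bounded[OF assms(2)]] by metis
  from has_integral_compact_support[OF assms(1,3) this] show ?thesis by blast
qed

lemma has_integral_translate_compact_support:
  fixes h :: "'a::euclidean_space \<Rightarrow> 'b::euclidean_space"
  assumes "continuous_on UNIV h" "compact S" "\<And>x. x \<notin> S \<Longrightarrow> h x = 0"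
  shows "((\<lambda>x. h (x + v)) has_integral integral UNIV h) UNIV"
proof -
  obtain a b where ab: "S \<subseteq> cbox a b"
    using bounded_subset_cbox_symmetric[OF compact_imp_bounded[OF assms(2)]] by metis
  have "(h has_integral integral (cbox a b) h) (cbox a b)"
    using integrable_integral[OF integrable_continuous[OF continuous_on_subset[OF assms(1)]]] by blast
  from has_integral_affinity[OF this, of 1 v]
  have *: "((\<lambda>x. h (x + v)) has_integral integral (cbox a b) h) ((\<lambda>x. x - v) ` cbox a b)"
    by simp
  have "((\<lambda>x. h (x + v)) has_integral integral (cbox a b) h) UNIV"
  proof (rule has_integral_on_superset[OF *])
    fix x assume "x \<notin> (\<lambda>x. x - v) ` cbox a b"
    then have "x + v \<notin> cbox a b" by (metis add_diff_cancel_right' imageI)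
    then show "h (x + v) = 0" using ab assms(3) by blast
  qed auto
  moreover have "integral UNIV h = integral (cbox a b) h"
    using has_integral_compact_support[OF assms(1,3) ab] by (simp add: integral_unique)
  ultimately show ?thesis by simp
qed

lemma derivative_zero_outside_support:
  fixes h :: "'a::real_normed_vector \<Rightarrow> 'b::real_normed_vector"
  assumes "(h has_derivative D) (at x)" "closed S" "\<And>y. y \<notin> S \<Longrightarrow> h y = 0" "x \<notin> S"
  shows "D = (\<lambda>_. 0)"
proof -
  have "(h has_derivative (\<lambda>_. 0)) (at x)"
    by (rule has_derivative_transform_within_open[of "\<lambda>_. 0" _ _ _ "- S"]) (use assms in auto)
  then show ?thesis using assms(1) has_derivative_unique by blast
qed

text \<open>By translation invariance the integral of \<open>x \<mapsto> h (x + t v)\<close> does not depend on \<open>t\<close>;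
  differentiate under the integral sign at \<open>t = 0\<close>.\<close>

lemma integral_directional_derivative_zero:
  fixes h :: "'a::euclidean_space \<Rightarrow> 'b::euclidean_space"
  assumes der: "\<And>x. (h has_derivative D x) (at x)"
    and cont: "continuous_on UNIV (\<lambda>x. D x v)"
    and S: "compact S" "\<And>x. x \<notin> S \<Longrightarrow> h x = 0"
  shows "integral UNIV (\<lambda>x. D x v) = 0"
proof -
  have conth: "continuous_on UNIV h"
    by (rule continuous_at_imp_continuous_on) (metis der has_derivative_continuous)
  \<comment> \<open>The set swept out by \<open>S\<close> contains the supports of all translates
    with \<open>t\<close> in \<open>{-1..1}\<close>, so one box serves for every
    \<open>t\<close>.\<close>
  define S' where "S' = (\<lambda>(t, x). x - t *\<^sub>R v) ` ({-1..1::real} \<times> S)"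
  have "compact S'"
    unfolding S'_def case_prod_beta
    by (intro compact_continuous_image compact_Times S(1) continuous_intros) auto
  then obtain a b where ab: "S' \<subseteq> cbox a b"
    using bounded_subset_cbox_symmetric[OF compact_imp_bounded] by metis
  have inS': "x \<in> S'" if "x + t *\<^sub>R v \<in> S" "t \<in> {-1..1}" for x t
    unfolding S'_def using that by (intro image_eqI[of _ _ "(t, x + t *\<^sub>R v)"]) auto
  have D0: "D x v = 0" if "x \<notin> S" for x
    using derivative_zero_outside_support[OF der compact_imp_closed[OF S(1)] S(2) that] by simp
  have shift: "integral (cbox a b) (\<lambda>x. h (x + t *\<^sub>R v)) = integral UNIV h" if "t \<in> {-1..1}" for t
  proof -
    have 1: "continuous_on UNIV (\<lambda>x. h (x + t *\<^sub>R v))"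
      by (intro continuous_on_compose2[OF conth] continuous_intros) auto
    have "x \<in> cbox a b" if "h (x + t *\<^sub>R v) \<noteq> 0" for x
      using inS' S(2) ab that \<open>t \<in> _\<close> by blast
    then have "((\<lambda>x. h (x + t *\<^sub>R v)) has_integral integral (cbox a b) (\<lambda>x. h (x + t *\<^sub>R v))) UNIV"
      by (intro has_integral_compact_support[OF 1, of "cbox a b"]) auto
    then show ?thesis
      using has_integral_translate_compact_support[OF conth S] has_integral_unique by blast
  qed
  have "((\<lambda>t. integral (cbox a b) (\<lambda>x. h (x + t *\<^sub>R v))) has_vector_derivative
      integral (cbox a b) (\<lambda>x. D (x + 0 *\<^sub>R v) v)) (at 0 within {-1<..<1::real})"
  proof (rule leibniz_rule_vector_derivative[where fx = "\<lambda>t x. D (x + t *\<^sub>R v) v"])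
    fix t :: real and x
    show "((\<lambda>t. h (x + t *\<^sub>R v)) has_vector_derivative D (x + t *\<^sub>R v) v) (at t within {-1<..<1})"
    proof -
      have "((\<lambda>t. x + t *\<^sub>R v) has_vector_derivative v) (at t within {-1<..<1})"
        by (auto intro!: derivative_eq_intros simp: has_vector_derivative_def)
      from vector_derivative_diff_chain_within[OF this has_derivative_at_withinI[OF der]]
      show ?thesis by (simp add: o_def)
    qed
    show "(\<lambda>x. h (x + t *\<^sub>R v)) integrable_on cbox a b"
      by (intro integrable_continuous continuous_on_compose2[OF conth] continuous_intros) auto
  next
    show "continuous_on ({- 1<..<1} \<times> cbox a b) (\<lambda>(t, x). D (x + t *\<^sub>R v) v)"
      unfolding case_prod_beta
      by (intro continuous_on_compose2[OF cont] continuous_intros) auto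
  qed auto
  moreover have "((\<lambda>t. integral (cbox a b) (\<lambda>x. h (x + t *\<^sub>R v))) has_vector_derivative 0)
       (at 0 within {-1<..<1::real})"
  proof (rule has_vector_derivative_transform)
    show "((\<lambda>_. integral UNIV h) has_vector_derivative 0) (at 0 within {-1<..<1::real})"
      by (rule has_vector_derivative_const)
    show "integral (cbox a b) (\<lambda>x. h (x + t *\<^sub>R v)) = integral UNIV h"
      if "t \<in> {-1<..<1}" for t :: real
      by (rule shift) (use that in auto)
  qed auto
  moreover have "at 0 within {-1<..<1::real} = at 0" by (rule at_within_open) auto
  ultimately have "integral (cbox a b) (\<lambda>x. D (x + 0 *\<^sub>R v) v) = 0"
    using vector_derivative_unique_at by simp
  then have "integral (cbox a b) (\<lambda>x. D x v) = 0" by simp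
  moreover have "S \<subseteq> cbox a b" using inS'[of _ 0] ab by auto
  ultimately show ?thesis
    using has_integral_compact_support[OF cont D0] integral_unique by metis
qed

section \<open>Plane gradients and integration by parts against holomorphic functions\<close>

definition has_gradient :: "(complex \<Rightarrow> real) \<Rightarrow> (complex \<Rightarrow> complex) \<Rightarrow> bool" where
  "has_gradient \<phi> G \<longleftrightarrow> continuous_on UNIV G \<and> (\<forall>\<zeta>. (\<phi> has_derivative (\<lambda>h. G \<zeta> \<bullet> h)) (at \<zeta>))"

lemma gradient_zero:
  assumes "has_gradient \<phi> G" "open N" "\<zeta> \<in> N" "\<And>w. w \<in> N \<Longrightarrow> \<phi> w = c"
  shows "G \<zeta> = 0"
proof -
  have "(\<phi> has_derivative (\<lambda>_. 0)) (at \<zeta>)"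
    by (rule has_derivative_transform_within_open[of "\<lambda>_. c" _ _ _ N]) (use assms in auto)
  then have "(\<lambda>h. G \<zeta> \<bullet> h) = (\<lambda>_. 0)"
    using assms(1) has_derivative_unique unfolding has_gradient_def by blast
  then have "G \<zeta> \<bullet> G \<zeta> = 0" by metis
  then show ?thesis by simp
qed

lemma continuous_on_UNIV_cover:
  assumes "open A" "open B" "A \<union> B = UNIV" "continuous_on A f" "continuous_on B f"
  shows "continuous_on UNIV f"
  using continuous_on_open_Un[of A B f] assms by auto

text \<open>For real \<open>\<phi>\<close> with gradient \<open>G\<close> (read as a complex number), \<open>G\<close> is twice the Wirtinger
  derivative of \<open>\<phi>\<close> with respect to the conjugate variable; so \<open>G g / 2\<close> is that of \<open>\<phi> g\<close>.\<close>

lemma integral_gradient_times_holomorphic: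
  assumes G: "has_gradient \<phi> G" and S: "compact S" "\<And>\<zeta>. \<zeta> \<notin> S \<Longrightarrow> \<phi> \<zeta> = 0"
    and W: "open W" "S \<subseteq> W" and g: "g holomorphic_on W"
  shows "integral UNIV (\<lambda>\<zeta>. G \<zeta> * g \<zeta>) = 0"
proof -
  define h where "h = (\<lambda>\<zeta>. of_real (\<phi> \<zeta>) * g \<zeta>)"
  define D where "D = (\<lambda>\<zeta> d. of_real (G \<zeta> \<bullet> d) * g \<zeta> + of_real (\<phi> \<zeta>) * (deriv g \<zeta> * d))"
  have clS: "closed S" using S(1) by (rule compact_imp_closed)
  have G0: "G \<zeta> = 0" if "\<zeta> \<notin> S" for \<zeta>
    using gradient_zero[OF G, of "- S" \<zeta> 0] that clS S(2) by auto
  have \<phi>: "(\<phi> has_derivative (\<lambda>h. G \<zeta> \<bullet> h)) (at \<zeta>)" for \<zeta> using G by (auto simp: has_gradient_def)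
  have cont\<phi>: "continuous_on UNIV \<phi>"
    by (rule continuous_at_imp_continuous_on) (metis \<phi> has_derivative_continuous)
  \<comment> \<open>Nothing is known of \<open>g\<close> off \<open>W\<close>. There
    \<open>h\<close> is locally zero, because \<open>\<phi>\<close> vanishes on the open set
    \<open>- S\<close>, and \<open>W\<close> and \<open>- S\<close> cover the plane.\<close>
  have der: "(h has_derivative D \<zeta>) (at \<zeta>)" for \<zeta>
  proof (cases "\<zeta> \<in> W")
    case True
    have "(g has_field_derivative deriv g \<zeta>) (at \<zeta>)"
      using g W True holomorphic_derivI by blast
    then have 1: "(g has_derivative (\<lambda>d. deriv g \<zeta> * d)) (at \<zeta>)"
      by (simp add: has_field_derivative_def)
    have 2: "((\<lambda>\<zeta>. complex_of_real (\<phi> \<zeta>)) has_derivative (\<lambda>d. of_real (G \<zeta> \<bullet> d))) (at \<zeta>)"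
      by (rule has_derivative_of_real[OF \<phi>])
    show ?thesis unfolding h_def
      by (rule has_derivative_eq_rhs[OF has_derivative_mult[OF 2 1]]) (auto simp: D_def)
  next
    case False
    then have "\<zeta> \<in> - S" using W by auto
    have "(h has_derivative (\<lambda>_. 0)) (at \<zeta>)"
      by (rule has_derivative_transform_within_open[of "\<lambda>_. 0" _ _ _ "- S"])
         (use \<open>\<zeta> \<in> - S\<close> clS S in \<open>auto simp: h_def\<close>)
    moreover have "D \<zeta> = (\<lambda>_. 0)" using \<open>\<zeta> \<in> - S\<close> G0 S by (auto simp: D_def)
    ultimately show ?thesis by simp
  qed
  have contD: "continuous_on UNIV (\<lambda>\<zeta>. D \<zeta> v)" for v
  proof (rule continuous_on_UNIV_cover[of W "- S"])
    have "continuous_on W g" "continuous_on W (deriv g)"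
      using g W(1) holomorphic_on_imp_continuous_on holomorphic_deriv by blast+
    moreover have "continuous_on W G" "continuous_on W \<phi>"
      using G cont\<phi> continuous_on_subset by (auto simp: has_gradient_def)
    ultimately show "continuous_on W (\<lambda>\<zeta>. D \<zeta> v)"
      unfolding D_def by (intro continuous_intros)
    have "continuous_on (- S) (\<lambda>\<zeta>. 0 :: complex)" by simp
    then show "continuous_on (- S) (\<lambda>\<zeta>. D \<zeta> v)"
      by (rule continuous_on_eq) (use G0 S in \<open>auto simp: D_def\<close>)
  qed (use W clS in auto)
  have D0: "D \<zeta> v = 0" if "\<zeta> \<notin> S" for \<zeta> v using G0 S that by (auto simp: D_def)
  have int: "integral UNIV (\<lambda>\<zeta>. D \<zeta> v) = 0" for v
    by (rule integral_directional_derivative_zero[OF der contD S(1)]) (use S in \<open>auto simp: h_def\<close>)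
  have intble: "(\<lambda>\<zeta>. D \<zeta> v) integrable_on UNIV" for v
    by (rule integrable_compact_support[OF contD S(1) D0])
  \<comment> \<open>The combination of the derivatives in directions 1 and \<open>\<i>\<close> is
    twice the Wirtinger derivative. The two \<open>deriv g\<close> terms cancel since
    \<open>\<i> * \<i> = - 1\<close>, and only \<open>G \<zeta> * g \<zeta>\<close>
    survives.\<close>
  have "((\<lambda>\<zeta>. D \<zeta> 1 + \<i> * D \<zeta> \<i>) has_integral 0 + \<i> * 0) UNIV"
    by (intro has_integral_add has_integral_mult_right) (metis int intble integrable_integral)+
  moreover have "D \<zeta> 1 + \<i> * D \<zeta> \<i> = G \<zeta> * g \<zeta>" for \<zeta>
  proof -
    have ii: "\<i> * (\<i> * x) = - x" for x by (simp flip: mult.assoc)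
    have "D \<zeta> 1 + \<i> * D \<zeta> \<i> = (of_real (Re (G \<zeta>)) + \<i> * of_real (Im (G \<zeta>))) * g \<zeta>"
      by (simp add: D_def inner_complex_def algebra_simps ii)
    then show ?thesis by (metis complex_eq)
  qed
  ultimately show ?thesis by (simp add: integral_unique)
qed

subsection \<open>Cutoff functions in the plane\<close>

lemma has_gradient_continuous: "has_gradient \<phi> G \<Longrightarrow> continuous_on S \<phi>"
  unfolding has_gradient_def
  by (rule continuous_at_imp_continuous_on) (metis has_derivative_continuous)

lemma has_gradient_const: "has_gradient (\<lambda>_. c) (\<lambda>_. 0)"
  by (simp add: has_gradient_def)

lemma has_gradient_add:
  assumes "has_gradient \<phi> G" "has_gradient \<psi> H"
  shows "has_gradient (\<lambda>\<zeta>. \<phi> \<zeta> + \<psi> \<zeta>) (\<lambda>\<zeta>. G \<zeta> + H \<zeta>)"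
  using assms unfolding has_gradient_def
  by (auto intro!: continuous_on_add derivative_eq_intros simp: inner_add_left)

lemma has_gradient_diff:
  assumes "has_gradient \<phi> G" "has_gradient \<psi> H"
  shows "has_gradient (\<lambda>\<zeta>. \<phi> \<zeta> - \<psi> \<zeta>) (\<lambda>\<zeta>. G \<zeta> - H \<zeta>)"
  using assms unfolding has_gradient_def
  by (auto intro!: continuous_on_diff derivative_eq_intros simp: inner_diff_left)

lemma has_gradient_sum:
  assumes "\<And>k. k \<in> I \<Longrightarrow> has_gradient (\<phi> k) (G k)"
  shows "has_gradient (\<lambda>\<zeta>. \<Sum>k\<in>I. \<phi> k \<zeta>) (\<lambda>\<zeta>. \<Sum>k\<in>I. G k \<zeta>)"
  unfolding has_gradient_def
proof (intro conjI allI)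
  show "continuous_on UNIV (\<lambda>\<zeta>. \<Sum>k\<in>I. G k \<zeta>)"
    using assms by (intro continuous_on_sum) (auto simp: has_gradient_def)
  fix \<zeta>
  have "((\<lambda>\<zeta>. \<Sum>k\<in>I. \<phi> k \<zeta>) has_derivative (\<lambda>h. \<Sum>k\<in>I. G k \<zeta> \<bullet> h)) (at \<zeta>)"
    by (rule has_derivative_sum) (use assms in \<open>auto simp: has_gradient_def\<close>)
  then show "((\<lambda>\<zeta>. \<Sum>k\<in>I. \<phi> k \<zeta>) has_derivative (\<lambda>h. (\<Sum>k\<in>I. G k \<zeta>) \<bullet> h)) (at \<zeta>)"
    by (simp add: inner_sum_left)
qed

lemma has_gradient_translate:
  assumes "has_gradient \<phi> G"
  shows "has_gradient (\<lambda>\<zeta>. \<phi> (\<zeta> + v)) (\<lambda>\<zeta>. G (\<zeta> + v))"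
  unfolding has_gradient_def
proof (intro conjI allI)
  show "continuous_on UNIV (\<lambda>\<zeta>. G (\<zeta> + v))"
    using assms unfolding has_gradient_def
    by (auto intro!: continuous_on_compose2[of UNIV G] continuous_intros)
  fix \<zeta>
  have 1: "((\<lambda>\<zeta>. \<zeta> + v) has_derivative (\<lambda>h. h)) (at \<zeta>)"
    by (auto intro!: derivative_eq_intros)
  have 2: "(\<phi> has_derivative (\<lambda>h. G (\<zeta> + v) \<bullet> h)) (at (\<zeta> + v))"
    using assms by (simp add: has_gradient_def)
  show "((\<lambda>\<zeta>. \<phi> (\<zeta> + v)) has_derivative (\<lambda>h. G (\<zeta> + v) \<bullet> h)) (at \<zeta>)"
    by (rule has_derivative_compose[OF 1 2])
qed

lemma has_gradient_compose:
  assumes G: "has_gradient \<phi> G" and P: "\<And>x::real. (P has_real_derivative P' x) (at x)"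
    and P': "continuous_on UNIV P'"
  shows "has_gradient (\<lambda>\<zeta>. P (\<phi> \<zeta>)) (\<lambda>\<zeta>. P' (\<phi> \<zeta>) *\<^sub>R G \<zeta>)"
  unfolding has_gradient_def
proof (intro conjI allI)
  show "continuous_on UNIV (\<lambda>\<zeta>. P' (\<phi> \<zeta>) *\<^sub>R G \<zeta>)"
    using G has_gradient_continuous[OF G] P' unfolding has_gradient_def
    by (auto intro!: continuous_on_compose2[OF P'] continuous_intros)
  fix \<zeta>
  have 1: "(\<phi> has_derivative (\<lambda>h. G \<zeta> \<bullet> h)) (at \<zeta>)" using G by (simp add: has_gradient_def)
  have 2: "(P has_derivative (\<lambda>h. P' (\<phi> \<zeta>) * h)) (at (\<phi> \<zeta>))"
    using P[of "\<phi> \<zeta>"] by (simp add: has_field_derivative_def)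
  show "((\<lambda>\<zeta>. P (\<phi> \<zeta>)) has_derivative (\<lambda>h. (P' (\<phi> \<zeta>) *\<^sub>R G \<zeta>) \<bullet> h)) (at \<zeta>)"
    using has_derivative_compose[OF 1 2] by simp
qed

lemma has_gradient_dist_sq: "has_gradient (\<lambda>\<zeta>. (norm (\<zeta> - c))\<^sup>2) (\<lambda>\<zeta>. 2 *\<^sub>R (\<zeta> - c))"
  unfolding has_gradient_def power2_norm_eq_inner
proof (intro conjI allI)
  show "continuous_on UNIV (\<lambda>\<zeta>. 2 *\<^sub>R (\<zeta> - c))" by (intro continuous_intros)
  fix \<zeta>
  have 1: "((\<lambda>\<zeta>. \<zeta> - c) has_derivative (\<lambda>h. h)) (at \<zeta>)"
    by (auto intro!: derivative_eq_intros)
  show "((\<lambda>\<zeta>. (\<zeta> - c) \<bullet> (\<zeta> - c)) has_derivative (\<lambda>h. (2 *\<^sub>R (\<zeta> - c)) \<bullet> h)) (at \<zeta>)"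
    by (rule has_derivative_eq_rhs[OF has_derivative_inner[OF 1 1]])
       (simp add: fun_eq_iff inner_commute)
qed

text \<open>Squaring removes the corner of the truncation at 0. This yields cutoffs of class C^1,
  the regularity that the integration by parts asks for.\<close>

lemma DERIV_max_0_sq: "((\<lambda>x::real. (max 0 x)\<^sup>2) has_real_derivative 2 * max 0 x) (at x)"
proof -
  consider "x > 0" | "x < 0" | "x = 0" by linarith
  then show ?thesis
  proof cases
    case 1
    have "((\<lambda>x::real. x\<^sup>2) has_real_derivative 2 * max 0 x) (at x)"
      using 1 by (auto intro!: derivative_eq_intros)
    then show ?thesis
      by (rule has_field_derivative_transform_within_open[of _ _ _ "{0<..}"]) (use 1 in auto)
  next
    case 2
    have "((\<lambda>x::real. 0) has_real_derivative 2 * max 0 x) (at x)"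
      using 2 by (auto intro!: derivative_eq_intros)
    then show ?thesis
      by (rule has_field_derivative_transform_within_open[of _ _ _ "{..<0}"]) (use 2 in auto)
  next
    case 3
    have "((\<lambda>h::real. ((max 0 (0 + h))\<^sup>2 - (max 0 0)\<^sup>2) / h) \<longlongrightarrow> 0) (at 0)"
    proof (rule Lim_null_comparison[where g = "\<lambda>h. \<bar>h\<bar>"])
      show "\<forall>\<^sub>F h in at 0. norm (((max 0 (0 + h))\<^sup>2 - (max 0 0)\<^sup>2) / h) \<le> \<bar>h::real\<bar>"
        by (intro always_eventually) (auto simp: max_def power2_eq_square)
      show "((\<lambda>h::real. \<bar>h\<bar>) \<longlongrightarrow> 0) (at 0)"
        by (auto intro!: tendsto_eq_intros)
    qed
    then show ?thesis using 3 by (simp add: DERIV_def)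
  qed
qed

lemma has_gradient_max_0_sq:
  "has_gradient \<phi> G \<Longrightarrow> has_gradient (\<lambda>\<zeta>. (max 0 (\<phi> \<zeta>))\<^sup>2) (\<lambda>\<zeta>. (2 * max 0 (\<phi> \<zeta>)) *\<^sub>R G \<zeta>)"
  by (rule has_gradient_compose[OF _ DERIV_max_0_sq]) (auto intro!: continuous_intros)

lemma has_gradient_scale:
  "has_gradient \<phi> G \<Longrightarrow> has_gradient (\<lambda>\<zeta>. a * \<phi> \<zeta>) (\<lambda>\<zeta>. a *\<^sub>R G \<zeta>)"
  by (rule has_gradient_compose[where P = "\<lambda>x. a * x" and P' = "\<lambda>_. a"])
     (auto intro!: derivative_eq_intros)

section \<open>Plateau functions and cutoff integrals\<close>

text \<open>The value 1 is taken on a whole neighbourhood of \<open>C\<close>, so \<open>G\<close>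
  vanishes there and singularities of \<open>g\<close> inside \<open>C\<close> do not affect
  \<open>G \<zeta> * g \<zeta>\<close>.\<close>

definition plateau ::
    "complex set \<Rightarrow> complex set \<Rightarrow> (complex \<Rightarrow> real) \<Rightarrow> (complex \<Rightarrow> complex) \<Rightarrow> bool" where
  "plateau C U \<phi> G \<longleftrightarrow> has_gradient \<phi> G \<and>
     (\<exists>N S. open N \<and> C \<subseteq> N \<and> compact S \<and> S \<subseteq> U \<and> (\<forall>\<zeta>\<in>N. \<phi> \<zeta> = 1) \<and> (\<forall>\<zeta>. \<zeta> \<notin> S \<longrightarrow> \<phi> \<zeta> = 0))"

text \<open>Finitely many balls with closures in \<open>U\<close> cover \<open>C\<close>. A sum of
  C^1 bumps on them is positive on \<open>C\<close>, and truncating it from above flattens it to 1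
  near \<open>C\<close>.\<close>

lemma plateau_exists:
  assumes "compact C" "open U" "C \<subseteq> U"
  obtains \<phi> G where "plateau C U \<phi> G"
proof -
  have "\<forall>c\<in>C. \<exists>r>0. cball c r \<subseteq> U"
    using assms open_contains_cball by blast
  then obtain r where r: "\<And>c. c \<in> C \<Longrightarrow> r c > 0" "\<And>c. c \<in> C \<Longrightarrow> cball c (r c) \<subseteq> U"
    by metis
  obtain D where D: "D \<subseteq> C" "finite D" "C \<subseteq> (\<Union>c\<in>D. ball c (r c))"
    using compactE_image[OF assms(1), of C "\<lambda>c. ball c (r c)"] r(1)
    by (metis (no_types, lifting) UN_I centre_in_ball open_ball subsetI)
  define \<psi> where "\<psi> = (\<lambda>\<zeta>. \<Sum>c\<in>D. (max 0 ((r c)\<^sup>2 - (norm (\<zeta> - c))\<^sup>2))\<^sup>2)"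
  define H where "H = (\<lambda>\<zeta>. \<Sum>c\<in>D.
    (2 * max 0 ((r c)\<^sup>2 - (norm (\<zeta> - c))\<^sup>2)) *\<^sub>R (0 - 2 *\<^sub>R (\<zeta> - c)))"
  have H: "has_gradient \<psi> H"
    unfolding \<psi>_def H_def
    by (intro has_gradient_sum has_gradient_max_0_sq has_gradient_diff has_gradient_const
        has_gradient_dist_sq)
  have pos: "\<psi> \<zeta> > 0" if "\<zeta> \<in> C" for \<zeta>
  proof -
    obtain c where "c \<in> D" "\<zeta> \<in> ball c (r c)" using D(3) \<open>\<zeta> \<in> C\<close> by blast
    then have c: "c \<in> D" "norm (\<zeta> - c) < r c" by (auto simp: dist_norm norm_minus_commute)
    then have "(norm (\<zeta> - c))\<^sup>2 < (r c)\<^sup>2" by (intro power_strict_mono) auto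
    then show ?thesis unfolding \<psi>_def using c D(2)
      by (intro sum_pos2[of _ c]) auto
  qed
  \<comment> \<open>The bound is strict so that \<open>{\<zeta>. m < \<psi> \<zeta>}\<close> is an
    open neighbourhood of \<open>C\<close>; hence half of the minimum.\<close>
  have "\<exists>m>0. \<forall>\<zeta>\<in>C. \<psi> \<zeta> > m"
  proof (cases "C = {}")
    case False
    then obtain x where "x \<in> C" "\<And>y. y \<in> C \<Longrightarrow> \<psi> x \<le> \<psi> y"
      using continuous_attains_inf[OF assms(1) _ has_gradient_continuous[OF H]] by blast
    then show ?thesis using pos by (intro exI[of _ "\<psi> x / 2"]) fastforce
  qed (auto intro: exI[of _ 1])
  then obtain m where m: "m > 0" "\<And>\<zeta>. \<zeta> \<in> C \<Longrightarrow> \<psi> \<zeta> > m" by blast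
  \<comment> \<open>This profile is 0 where \<open>\<psi>\<close> is 0 and 1 where
    \<open>\<psi>\<close> is at least \<open>m\<close>, and it is C^1 in between.\<close>
  define \<phi> where "\<phi> = (\<lambda>\<zeta>. 1 - (max 0 (1 - (1/m) * \<psi> \<zeta>))\<^sup>2)"
  obtain G where G: "has_gradient \<phi> G"
    unfolding \<phi>_def
    using has_gradient_diff[OF has_gradient_const has_gradient_max_0_sq[OF
          has_gradient_diff[OF has_gradient_const has_gradient_scale[OF H]]]] by blast
  define S where "S = (\<Union>c\<in>D. cball c (r c))"
  have "\<psi> \<zeta> = 0" if "\<zeta> \<notin> S" for \<zeta>
    unfolding \<psi>_def
  proof (intro sum.neutral ballI)
    fix c assume "c \<in> D"
    then have "r c < norm (\<zeta> - c)" "r c > 0" using that D r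
      by (auto simp: S_def dist_norm norm_minus_commute)
    then have "(r c)\<^sup>2 < (norm (\<zeta> - c))\<^sup>2" by (intro power_strict_mono) auto
    then show "(max 0 ((r c)\<^sup>2 - (cmod (\<zeta> - c))\<^sup>2))\<^sup>2 = 0" by simp
  qed
  then have out: "\<phi> \<zeta> = 0" if "\<zeta> \<notin> S" for \<zeta> using that by (simp add: \<phi>_def)
  define N where "N = {\<zeta>. m < \<psi> \<zeta>}"
  have "open N" unfolding N_def
    by (intro open_Collect_less has_gradient_continuous[OF H] continuous_intros)
  moreover have "\<phi> \<zeta> = 1" if "\<zeta> \<in> N" for \<zeta>
    using that m(1) by (simp add: \<phi>_def N_def)
  moreover have "compact S" unfolding S_def using D(2) by auto
  moreover have "S \<subseteq> U" unfolding S_def using D(1) r(2) by blast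
  moreover have "C \<subseteq> N" using m by (auto simp: N_def)
  ultimately have "plateau C U \<phi> G" unfolding plateau_def using G out by blast
  then show ?thesis by (rule that)
qed

lemma plateau_mono: "plateau C' U' \<phi> G \<Longrightarrow> C \<subseteq> C' \<Longrightarrow> U' \<subseteq> U \<Longrightarrow> plateau C U \<phi> G"
  unfolding plateau_def by (meson order_trans)

lemma plateau_gradient_eq_0:
  assumes "has_gradient \<phi> G" "open N" "compact S"
    "\<And>\<zeta>. \<zeta> \<in> N \<Longrightarrow> \<phi> \<zeta> = 1" "\<And>\<zeta>. \<zeta> \<notin> S \<Longrightarrow> \<phi> \<zeta> = 0" "\<zeta> \<notin> S - N"
  shows "G \<zeta> = 0"
proof (cases "\<zeta> \<in> N")
  case True then show ?thesis using gradient_zero assms by blast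
next
  case False
  then show ?thesis
    using gradient_zero[OF assms(1), of "- S" \<zeta> 0] assms compact_imp_closed by auto
qed

text \<open>The gradient lives on the compact set \<open>S - N\<close>, which lies in
  \<open>U - C\<close>, where \<open>g\<close> is continuous; elsewhere the integrand is 0 whatever
  the values of \<open>g\<close>.\<close>

lemma plateau_integrable:
  assumes "plateau C U \<phi> G" "open U" "closed C" "g holomorphic_on U - C"
  shows "(\<lambda>\<zeta>. G \<zeta> * g \<zeta>) integrable_on UNIV"
proof -
  obtain N S where NS: "open N" "C \<subseteq> N" "compact S" "S \<subseteq> U" "\<And>\<zeta>. \<zeta> \<in> N \<Longrightarrow> \<phi> \<zeta> = 1"
      "\<And>\<zeta>. \<zeta> \<notin> S \<Longrightarrow> \<phi> \<zeta> = 0" and G: "has_gradient \<phi> G"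
    using assms(1) unfolding plateau_def by auto
  have cl: "compact (S - N)" using NS by (intro compact_diff)
  have G0: "G \<zeta> = 0" if "\<zeta> \<notin> S - N" for \<zeta>
    by (rule plateau_gradient_eq_0[OF G NS(1,3,5,6) that])
  have "continuous_on UNIV (\<lambda>\<zeta>. G \<zeta> * g \<zeta>)"
  proof (rule continuous_on_UNIV_cover[of "U - C" "- (S - N)"])
    show "continuous_on (U - C) (\<lambda>\<zeta>. G \<zeta> * g \<zeta>)"
      using G unfolding has_gradient_def
      by (intro continuous_on_mult holomorphic_on_imp_continuous_on[OF assms(4)])
         (auto intro: continuous_on_subset)
    have "continuous_on (- (S - N)) (\<lambda>\<zeta>. 0 :: complex)" by simp
    then show "continuous_on (- (S - N)) (\<lambda>\<zeta>. G \<zeta> * g \<zeta>)"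
      by (rule continuous_on_eq) (use G0 in auto)
  qed (use assms NS compact_imp_closed[OF NS(3)] in auto)
  then show ?thesis
    by (rule integrable_compact_support[OF _ cl]) (use G0 in auto)
qed

text \<open>The difference of two plateau functions has compact support inside \<open>U - C\<close>,
  so its gradient integrates to zero against \<open>g\<close>.\<close>

lemma plateau_integral_unique:
  assumes "plateau C U \<phi> G" "plateau C U \<psi> H" "open U" "closed C" "g holomorphic_on U - C"
  shows "integral UNIV (\<lambda>\<zeta>. G \<zeta> * g \<zeta>) = integral UNIV (\<lambda>\<zeta>. H \<zeta> * g \<zeta>)"
proof -
  obtain N S where NS: "open N" "C \<subseteq> N" "compact S" "S \<subseteq> U" "\<And>\<zeta>. \<zeta> \<in> N \<Longrightarrow> \<phi> \<zeta> = 1"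
      "\<And>\<zeta>. \<zeta> \<notin> S \<Longrightarrow> \<phi> \<zeta> = 0" and G: "has_gradient \<phi> G"
    using assms(1) unfolding plateau_def by auto
  obtain N' S' where NS': "open N'" "C \<subseteq> N'" "compact S'" "S' \<subseteq> U" "\<And>\<zeta>. \<zeta> \<in> N' \<Longrightarrow> \<psi> \<zeta> = 1"
      "\<And>\<zeta>. \<zeta> \<notin> S' \<Longrightarrow> \<psi> \<zeta> = 0" and H: "has_gradient \<psi> H"
    using assms(2) unfolding plateau_def by auto
  have "integral UNIV (\<lambda>\<zeta>. (G \<zeta> - H \<zeta>) * g \<zeta>) = 0"
  proof (rule integral_gradient_times_holomorphic[OF has_gradient_diff[OF G H] _ _ _ _ assms(5)])
    show "compact ((S \<union> S') - (N \<inter> N'))"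
      using NS NS' by (intro compact_diff) auto
    show "S \<union> S' - N \<inter> N' \<subseteq> U - C" using NS NS' by auto
    fix \<zeta> assume "\<zeta> \<notin> S \<union> S' - N \<inter> N'"
    then show "\<phi> \<zeta> - \<psi> \<zeta> = 0" using NS NS' by auto
  qed (use assms in auto)
  then show ?thesis
    using integral_diff[OF plateau_integrable[OF assms(1,3,4,5)] plateau_integrable[OF assms(2,3,4,5)]]
    by (simp add: left_diff_distrib)
qed

text \<open>Smooth substitute for the contour integral of \<open>g\<close> along a cycle in \<open>U - C\<close> that winds once around
  \<open>C\<close>: for \<open>g\<close> holomorphic on \<open>U - C\<close> the value does not depend on the chosen plateau function.\<close>

definition cutoff_integral :: "complex set \<Rightarrow> complex set \<Rightarrow> (complex \<Rightarrow> complex) \<Rightarrow> complex" where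
  "cutoff_integral C U g = (SOME I. \<exists>\<phi> G. plateau C U \<phi> G \<and> I = integral UNIV (\<lambda>\<zeta>. G \<zeta> * g \<zeta>))"

lemma cutoff_integral_eq:
  assumes "plateau C U \<phi> G" "open U" "closed C" "g holomorphic_on U - C"
  shows "cutoff_integral C U g = integral UNIV (\<lambda>\<zeta>. G \<zeta> * g \<zeta>)"
proof -
  have "\<exists>\<psi> H. plateau C U \<psi> H \<and> cutoff_integral C U g = integral UNIV (\<lambda>\<zeta>. H \<zeta> * g \<zeta>)"
    unfolding cutoff_integral_def
    by (rule someI[of _ "integral UNIV (\<lambda>\<zeta>. G \<zeta> * g \<zeta>)"]) (use assms in blast)
  then show ?thesis using plateau_integral_unique[OF _ assms(1) assms(2-4)] by metis
qed

text \<open>Takes the place of deforming the cycle: a plateau function for the narrower pair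
  \<open>C'\<close>, \<open>U'\<close> is one for \<open>C\<close>, \<open>U\<close> as well, so
  both values come from the same integral.\<close>

lemma cutoff_integral_mono:
  assumes "open U" "closed C" "g holomorphic_on U - C"
    and "open U'" "compact C'" "C \<subseteq> C'" "C' \<subseteq> U'" "U' \<subseteq> U"
  shows "cutoff_integral C' U' g = cutoff_integral C U g"
proof -
  obtain \<phi> G where p: "plateau C' U' \<phi> G" using plateau_exists assms by metis
  have "g holomorphic_on U' - C'"
    by (rule holomorphic_on_subset[OF assms(3)]) (use assms in auto)
  then show ?thesis
    using cutoff_integral_eq[OF p assms(4) compact_imp_closed[OF assms(5)]]
      cutoff_integral_eq[OF plateau_mono[OF p assms(6,8)] assms(1-3)] by simp
qed

text \<open>Cauchy's theorem in this setting: with no singular set, the zero function is an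
  admissible plateau function.\<close>

lemma cutoff_integral_empty:
  assumes "open U" "g holomorphic_on U"
  shows "cutoff_integral {} U g = 0"
proof -
  have "plateau {} U (\<lambda>_. 0) (\<lambda>_. 0)"
    unfolding plateau_def using has_gradient_const by blast
  from cutoff_integral_eq[OF this] show ?thesis using assms by simp
qed

text \<open>Corresponds to adding cycles: plateau functions with supports in disjoint open sets add
  up to one for the union.\<close>

lemma cutoff_integral_Un:
  assumes "open U1" "compact C1" "C1 \<subseteq> U1" "g holomorphic_on U1 - C1"
    and "open U2" "compact C2" "C2 \<subseteq> U2" "g holomorphic_on U2 - C2"
    and "U1 \<inter> U2 = {}"
  shows "cutoff_integral (C1 \<union> C2) (U1 \<union> U2) g = cutoff_integral C1 U1 g + cutoff_integral C2 U2 g"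
proof -
  have cl: "closed C1" "closed C2" using assms compact_imp_closed by auto
  obtain \<phi> G where p1: "plateau C1 U1 \<phi> G" using plateau_exists assms by metis
  obtain \<psi> H where p2: "plateau C2 U2 \<psi> H" using plateau_exists assms by metis
  obtain N S where NS: "open N" "C1 \<subseteq> N" "compact S" "S \<subseteq> U1" "\<And>\<zeta>. \<zeta> \<in> N \<Longrightarrow> \<phi> \<zeta> = 1"
      "\<And>\<zeta>. \<zeta> \<notin> S \<Longrightarrow> \<phi> \<zeta> = 0" and G: "has_gradient \<phi> G"
    using p1 unfolding plateau_def by auto
  obtain N' S' where NS': "open N'" "C2 \<subseteq> N'" "compact S'" "S' \<subseteq> U2" "\<And>\<zeta>. \<zeta> \<in> N' \<Longrightarrow> \<psi> \<zeta> = 1"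
      "\<And>\<zeta>. \<zeta> \<notin> S' \<Longrightarrow> \<psi> \<zeta> = 0" and H: "has_gradient \<psi> H"
    using p2 unfolding plateau_def by auto
  have "plateau (C1 \<union> C2) (U1 \<union> U2) (\<lambda>\<zeta>. \<phi> \<zeta> + \<psi> \<zeta>) (\<lambda>\<zeta>. G \<zeta> + H \<zeta>)"
    unfolding plateau_def
  proof (intro conjI exI)
    \<comment> \<open>Off the support of the other summand the sum is \<open>1 + 0\<close> or
      \<open>0 + 1\<close>. No point of \<open>C1\<close> or \<open>C2\<close> is lost, since the
      supports lie in the disjoint sets \<open>U1\<close> and \<open>U2\<close>.\<close>
    show "open ((N - S') \<union> (N' - S))" using NS NS' compact_imp_closed by blast
    show "C1 \<union> C2 \<subseteq> (N - S') \<union> (N' - S)" using NS NS' assms by blast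
    show "compact (S \<union> S')" "S \<union> S' \<subseteq> U1 \<union> U2" using NS NS' by auto
  qed (use NS NS' has_gradient_add[OF G H] in auto)
  moreover have "g holomorphic_on (U1 \<union> U2) - (C1 \<union> C2)"
  proof -
    have "g holomorphic_on (U1 - C1) \<union> (U2 - C2)"
      using assms cl by (intro holomorphic_on_Un) auto
    then show ?thesis by (rule holomorphic_on_subset) auto
  qed
  ultimately have "cutoff_integral (C1 \<union> C2) (U1 \<union> U2) g = integral UNIV (\<lambda>\<zeta>. (G \<zeta> + H \<zeta>) * g \<zeta>)"
    using assms cl by (intro cutoff_integral_eq) auto
  also have "\<dots> = integral UNIV (\<lambda>\<zeta>. G \<zeta> * g \<zeta>) + integral UNIV (\<lambda>\<zeta>. H \<zeta> * g \<zeta>)"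
    using integral_add[OF plateau_integrable[OF p1 assms(1) cl(1) assms(4)]
        plateau_integrable[OF p2 assms(5) cl(2) assms(8)]] by (simp add: distrib_right)
  finally show ?thesis
    using cutoff_integral_eq[OF p1 assms(1) cl(1) assms(4)]
      cutoff_integral_eq[OF p2 assms(5) cl(2) assms(8)] by simp
qed

text \<open>The counterpart of 2 pi i in Cauchy's formula. Its value is -2 pi, but the development
  uses only that it is nonzero.\<close>

definition cauchy_const :: complex where
  "cauchy_const = cutoff_integral {0} UNIV (\<lambda>\<zeta>. 1 / \<zeta>)"

text \<open>A radial cutoff \<open>p (|\<zeta>|\<^sup>2)\<close> has gradient \<open>2 p' (|\<zeta>|\<^sup>2) \<zeta>\<close>, so the integrand is
  \<open>2 p' (|\<zeta>|\<^sup>2)\<close>, which is nonpositive and not identically zero.\<close>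

lemma cauchy_const_nonzero: "cauchy_const \<noteq> 0"
proof -
  define q where "q = (\<lambda>\<zeta>::complex. max 0 ((norm (\<zeta> - 0))\<^sup>2 - 1))"
  define \<phi> where "\<phi> = (\<lambda>\<zeta>. (max 0 (1 - (q \<zeta>)\<^sup>2))\<^sup>2)"
  define G where "G = (\<lambda>\<zeta>. (2 * max 0 (1 - (q \<zeta>)\<^sup>2)) *\<^sub>R (0 - (2 * q \<zeta>) *\<^sub>R (2 *\<^sub>R (\<zeta> - 0) - 0)))"
  \<comment> \<open>This is \<open>G \<zeta> / \<zeta>\<close>, real because the gradient is radial;
    at 0 both are 0 since \<open>q\<close> vanishes there. The cutoff is 1 on the unit disc and 0
    once the squared modulus reaches 2.\<close>
  define k where "k = (\<lambda>\<zeta>. - (8 * max 0 (1 - (q \<zeta>)\<^sup>2) * q \<zeta>))"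
  have G: "has_gradient \<phi> G" unfolding \<phi>_def G_def q_def
    by (intro has_gradient_max_0_sq has_gradient_diff has_gradient_const has_gradient_dist_sq)
  have big: "\<phi> \<zeta> = 0" "k \<zeta> = 0" if "\<zeta> \<notin> cball 0 2" for \<zeta>
  proof -
    have "2\<^sup>2 < (norm \<zeta>)\<^sup>2" using that by (intro power_strict_mono) auto
    then have "q \<zeta> \<ge> 1" by (auto simp: q_def)
    then have "(q \<zeta>)\<^sup>2 \<ge> 1" by simp
    then show "\<phi> \<zeta> = 0" "k \<zeta> = 0" by (auto simp: \<phi>_def k_def)
  qed
  have small: "\<phi> \<zeta> = 1" if "\<zeta> \<in> ball 0 1" for \<zeta>
  proof -
    have "(norm \<zeta>)\<^sup>2 \<le> 1\<^sup>2" using that by (intro power_mono) auto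
    then show ?thesis by (simp add: \<phi>_def q_def)
  qed
  have "plateau {0} UNIV \<phi> G"
    unfolding plateau_def
    by (intro conjI G exI[of _ "ball 0 1"] exI[of _ "cball 0 2"]) (use big small in auto)
  then have "cauchy_const = integral UNIV (\<lambda>\<zeta>. G \<zeta> * (1 / \<zeta>))"
    unfolding cauchy_const_def by (rule cutoff_integral_eq) (auto intro!: holomorphic_intros)
  also have "(\<lambda>\<zeta>. G \<zeta> * (1 / \<zeta>)) = (\<lambda>\<zeta>. complex_of_real (k \<zeta>))"
    by (auto simp: G_def k_def q_def scaleR_conv_of_real field_simps)
  also have "integral UNIV (\<lambda>\<zeta>. complex_of_real (k \<zeta>)) = complex_of_real (integral UNIV k)"
  proof -
    have "k integrable_on UNIV"
      by (rule integrable_compact_support[of _ "cball 0 2"])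
         (use big in \<open>auto simp: k_def q_def intro!: continuous_intros\<close>)
    then show ?thesis
      using integral_linear[OF _ bounded_linear_of_real, of k UNIV] by (simp add: o_def)
  qed
  finally have eq: "cauchy_const = complex_of_real (integral UNIV k)" .
  have contk: "continuous_on S k" for S unfolding k_def q_def by (intro continuous_intros)
  have "integral UNIV k \<noteq> 0"
  proof
    assume 0: "integral UNIV k = 0"
    obtain c where c: "cball 0 2 \<subseteq> cbox (- c) (c::complex)"
      using bounded_subset_cbox_symmetric[OF bounded_cball] by metis
    have "(k has_integral integral (cbox (-c) c) k) UNIV"
      by (rule has_integral_compact_support[OF contk _ c]) (use big in auto)
    then have "integral (cbox (-c) c) k = 0" using 0 integral_unique by metis
    then have "((\<lambda>\<zeta>. - k \<zeta>) has_integral 0) (cbox (-c) c)"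
      using has_integral_neg[OF integrable_integral[OF integrable_continuous[OF contk]]]
      by (metis neg_equal_0_iff_equal)
    \<comment> \<open>The squared modulus 25/16 lies strictly between 1 and 2, where
      \<open>k\<close> is negative. But a nonnegative continuous function with integral zero over a
      box vanishes on it.\<close>
    moreover define w where "w = complex_of_real (5/4)"
    have w: "w \<in> cbox (-c) c" using c by (auto simp: w_def)
    moreover have "box (-c) c \<noteq> {}"
    proof -
      have "ball 0 1 \<subseteq> interior (cbox (-c) c)"
        using c by (intro interior_maximal) auto
      then show ?thesis by (metis interior_cbox centre_in_ball empty_iff subsetD zero_less_one)
    qed
    ultimately have "- k w = 0"
      by (intro has_integral_0_cbox_imp_0[of "-c" c "\<lambda>\<zeta>. - k \<zeta>"] continuous_on_minus contk w)
         (auto simp: k_def q_def)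
    moreover have "k w < 0" by (simp add: k_def q_def w_def power2_eq_square)
    ultimately show False by simp
  qed
  then show ?thesis unfolding eq by (metis of_real_eq_0_iff)
qed

text \<open>Split the kernel into the difference quotient of \<open>h\<close> at \<open>w\<close>,
  which extends holomorphically and contributes 0, and \<open>h w / (\<zeta> - w)\<close>, whose
  integral is found by translating \<open>w\<close> to 0.\<close>

lemma cutoff_integral_Cauchy:
  assumes "open U" "w \<in> U" "h holomorphic_on U"
  shows "cutoff_integral {w} U (\<lambda>\<zeta>. h \<zeta> / (\<zeta> - w)) = cauchy_const * h w"
proof -
  obtain \<phi> G where p: "plateau {w} U \<phi> G" using plateau_exists[of "{w}" U] assms by auto
  obtain N S where NS: "open N" "w \<in> N" "compact S" "S \<subseteq> U" "\<And>\<zeta>. \<zeta> \<in> N \<Longrightarrow> \<phi> \<zeta> = 1"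
      "\<And>\<zeta>. \<zeta> \<notin> S \<Longrightarrow> \<phi> \<zeta> = 0" and G: "has_gradient \<phi> G"
    using p unfolding plateau_def by auto
  have Gw: "G w = 0" using plateau_gradient_eq_0[OF G NS(1,3,5,6)] NS by auto
  define k where "k = (\<lambda>\<zeta>. if \<zeta> = w then deriv h w else (h \<zeta> - h w) / (\<zeta> - w))"
  have k: "k holomorphic_on U" unfolding k_def
    by (rule pole_lemma_open) (use assms in auto)
  have "cutoff_integral {w} U (\<lambda>\<zeta>. h \<zeta> / (\<zeta> - w)) = integral UNIV (\<lambda>\<zeta>. G \<zeta> * (h \<zeta> / (\<zeta> - w)))"
    using assms p by (intro cutoff_integral_eq) (auto intro!: holomorphic_intros elim: holomorphic_on_subset)
  \<comment> \<open>At \<open>\<zeta> = w\<close>, where the quotients are division by zero and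
    \<open>k\<close> is the derivative, both sides are 0 because \<open>G w = 0\<close>.\<close>
  also have "(\<lambda>\<zeta>. G \<zeta> * (h \<zeta> / (\<zeta> - w))) = (\<lambda>\<zeta>. G \<zeta> * k \<zeta> + h w * (G \<zeta> * (1 / (\<zeta> - w))))"
    using Gw by (auto simp: k_def fun_eq_iff diff_divide_distrib right_diff_distrib)
  also have "integral UNIV \<dots> = integral UNIV (\<lambda>\<zeta>. G \<zeta> * k \<zeta>)
      + h w * integral UNIV (\<lambda>\<zeta>. G \<zeta> * (1 / (\<zeta> - w)))"
  proof (subst integral_add)
    show "(\<lambda>\<zeta>. G \<zeta> * k \<zeta>) integrable_on UNIV"
      by (rule plateau_integrable[OF p assms(1)]) (use k in \<open>auto elim: holomorphic_on_subset\<close>)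
    show "(\<lambda>\<zeta>. h w * (G \<zeta> * (1 / (\<zeta> - w)))) integrable_on UNIV"
      by (intro integrable_on_mult_right plateau_integrable[OF p assms(1)]) (auto intro!: holomorphic_intros)
  qed (simp only: Henstock_Kurzweil_Integration.integral_mult_right)
  also have "integral UNIV (\<lambda>\<zeta>. G \<zeta> * k \<zeta>) = 0"
    by (rule integral_gradient_times_holomorphic[OF G NS(3,6) assms(1) NS(4) k])
  also have "integral UNIV (\<lambda>\<zeta>. G \<zeta> * (1 / (\<zeta> - w))) = cauchy_const"
  proof -
    have 1: "continuous_on UNIV (\<lambda>\<zeta>. G \<zeta> * (1 / (\<zeta> - w)))"
    proof (rule continuous_on_UNIV_cover[of "- {w}" N])
      show "continuous_on (- {w}) (\<lambda>\<zeta>. G \<zeta> * (1 / (\<zeta> - w)))"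
        using G by (auto simp: has_gradient_def intro!: continuous_intros elim: continuous_on_subset)
      have "continuous_on N (\<lambda>\<zeta>. 0 :: complex)" by simp
      then show "continuous_on N (\<lambda>\<zeta>. G \<zeta> * (1 / (\<zeta> - w)))"
        by (rule continuous_on_eq) (use plateau_gradient_eq_0[OF G NS(1,3,5,6)] in auto)
    qed (use NS in auto)
    have "plateau {0} UNIV (\<lambda>\<zeta>. \<phi> (\<zeta> + w)) (\<lambda>\<zeta>. G (\<zeta> + w))"
      unfolding plateau_def
    proof (intro conjI exI has_gradient_translate G)
      show "open ((\<lambda>\<zeta>. \<zeta> + w) -` N)" by (intro open_vimage NS continuous_intros)
      show "compact ((\<lambda>\<zeta>. \<zeta> - w) ` S)" by (intro compact_continuous_image NS continuous_intros)
      show "\<forall>\<zeta>. \<zeta> \<notin> (\<lambda>\<zeta>. \<zeta> - w) ` S \<longrightarrow> \<phi> (\<zeta> + w) = 0"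
        using NS(6) by (metis add_diff_cancel_right' imageI)
    qed (use NS in auto)
    then have "cauchy_const = integral UNIV (\<lambda>\<zeta>. G (\<zeta> + w) * (1 / \<zeta>))"
      unfolding cauchy_const_def by (intro cutoff_integral_eq) (auto intro!: holomorphic_intros)
    moreover have "((\<lambda>\<zeta>. G (\<zeta> + w) * (1 / (\<zeta> + w - w))) has_integral
        integral UNIV (\<lambda>\<zeta>. G \<zeta> * (1 / (\<zeta> - w)))) UNIV"
      by (rule has_integral_translate_compact_support[OF 1 NS(3)])
         (use plateau_gradient_eq_0[OF G NS(1,3,5,6)] in auto)
    ultimately show ?thesis by (simp add: integral_unique)
  qed
  finally show ?thesis by simp
qed

subsection \<open>Holomorphic functions of several variables\<close>

lemma bounded_linear_vector_smult: "bounded_linear (\<lambda>c. c *s (v :: complex^'n))"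
proof -
  have "linear (\<lambda>c. c *s v)"
    by (rule linearI) (simp_all add: vec_eq_iff distrib_right)
  then show ?thesis by (simp add: linear_conv_bounded_linear)
qed

lemma holo_on_subset: "holo_on U f \<Longrightarrow> V \<subseteq> U \<Longrightarrow> holo_on V f"
  unfolding holo_on_def by blast

lemma holo_on_continuous_on: "holo_on U f \<Longrightarrow> continuous_on U f"
  unfolding holo_on_def
  by (rule continuous_at_imp_continuous_on) (metis has_derivative_continuous)

lemma holo_on_frechet_derivative:
  assumes "holo_on U f" "z \<in> U"
  shows "(f has_derivative frechet_derivative f (at z)) (at z)"
    and "frechet_derivative f (at z) (c *s x) = c * frechet_derivative f (at z) x"
proof -
  obtain L where L: "(f has_derivative L) (at z)" "\<And>c x. L (c *s x) = c * L x"
    using assms unfolding holo_on_def by blast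
  moreover have "L = frechet_derivative f (at z)" by (rule frechet_derivative_at[OF L(1)])
  ultimately show "(f has_derivative frechet_derivative f (at z)) (at z)"
    and "frechet_derivative f (at z) (c *s x) = c * frechet_derivative f (at z) x" by auto
qed

lemma holo_on_transform:
  assumes "holo_on U f" "open U" "\<And>z. z \<in> U \<Longrightarrow> g z = f z"
  shows "holo_on U g"
  unfolding holo_on_def
proof
  fix z assume "z \<in> U"
  then obtain L where L: "(f has_derivative L) (at z)" "\<forall>c x. L (c *s x) = c * L x"
    using assms(1) unfolding holo_on_def by blast
  have "(g has_derivative L) (at z)"
    by (rule has_derivative_transform_within_open[OF L(1) assms(2) \<open>z \<in> U\<close>]) (use assms in auto)
  then show "\<exists>L. (g has_derivative L) (at z) \<and> (\<forall>c x. L (c *s x) = c * L x)" using L by blast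
qed

lemma holo_on_Un: "holo_on U f \<Longrightarrow> holo_on V f \<Longrightarrow> holo_on (U \<union> V) f"
  unfolding holo_on_def by blast

lemma holo_on_const: "holo_on U (\<lambda>_. c)"
  unfolding holo_on_def by (intro ballI exI[of _ "\<lambda>_. 0"]) simp

lemma holo_on_diff:
  assumes "holo_on U f" "holo_on U g"
  shows "holo_on U (\<lambda>z. f z - g z)"
  unfolding holo_on_def
proof
  fix z assume z: "z \<in> U"
  note f = holo_on_frechet_derivative[OF assms(1) z]
  note g = holo_on_frechet_derivative[OF assms(2) z]
  show "\<exists>L. ((\<lambda>z. f z - g z) has_derivative L) (at z) \<and> (\<forall>c x. L (c *s x) = c * L x)"
    using has_derivative_diff[OF f(1) g(1)]
    by (intro exI conjI, assumption) (simp add: f(2) g(2) algebra_simps)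
qed

lemma holo_on_mult:
  assumes "holo_on U f" "holo_on U g"
  shows "holo_on U (\<lambda>z. f z * g z)"
  unfolding holo_on_def
proof
  fix z assume z: "z \<in> U"
  note f = holo_on_frechet_derivative[OF assms(1) z]
  note g = holo_on_frechet_derivative[OF assms(2) z]
  show "\<exists>L. ((\<lambda>z. f z * g z) has_derivative L) (at z) \<and> (\<forall>c x. L (c *s x) = c * L x)"
    using has_derivative_mult[OF f(1) g(1)]
    by (intro exI conjI, assumption) (simp add: f(2) g(2) algebra_simps)
qed

lemma holo_on_inverse:
  assumes "holo_on U f" "\<And>z. z \<in> U \<Longrightarrow> f z \<noteq> 0"
  shows "holo_on U (\<lambda>z. inverse (f z))"
  unfolding holo_on_def
proof
  fix z assume z: "z \<in> U"
  note f = holo_on_frechet_derivative[OF assms(1) z]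
  show "\<exists>L. ((\<lambda>z. inverse (f z)) has_derivative L) (at z) \<and> (\<forall>c x. L (c *s x) = c * L x)"
    using Deriv.has_derivative_inverse[OF assms(2)[OF z] f(1)]
    by (intro exI conjI, assumption) (simp add: f(2) algebra_simps)
qed

text \<open>Complex homogeneity of the Frechet derivative turns the real chain rule into a complex
  derivative along the line.\<close>

lemma holo_on_line_derivative:
  fixes a v :: "complex^'n"
  assumes "holo_on U f" "a + t *s v \<in> U"
  shows "((\<lambda>t. f (a + t *s v)) has_field_derivative frechet_derivative f (at (a + t *s v)) v) (at t)"
proof -
  have 1: "((\<lambda>t. a + t *s v) has_derivative (\<lambda>h. h *s v)) (at t)"
    using has_derivative_add[OF has_derivative_const[of a]
        bounded_linear_imp_has_derivative[OF bounded_linear_vector_smult[of v]]] by simp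
  show ?thesis
    using has_derivative_compose[OF 1 holo_on_frechet_derivative(1)[OF assms]]
    unfolding has_field_derivative_def
    by (rule has_derivative_eq_rhs) (simp add: fun_eq_iff holo_on_frechet_derivative(2)[OF assms])
qed

lemma continuous_on_line: "continuous_on S (\<lambda>t. a + t *s (v :: complex^'n))"
  by (rule continuous_on_add[OF continuous_on_const
        linear_continuous_on[OF bounded_linear_vector_smult]])

lemma open_line_vimage: "open U \<Longrightarrow> open {t. a + t *s (v :: complex^'n) \<in> U}"
  using open_vimage[OF _ continuous_on_line[of UNIV a v], of U] by (simp add: vimage_def)

lemma holomorphic_on_line:
  fixes a v :: "complex^'n"
  assumes "holo_on U f"
  shows "(\<lambda>t. f (a + t *s v)) holomorphic_on {t. a + t *s v \<in> U}"
proof (rule holomorphic_onI)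
  fix t assume "t \<in> {t. a + t *s v \<in> U}"
  then have "(\<lambda>t. f (a + t *s v)) field_differentiable (at t)"
    using holo_on_line_derivative[OF assms] unfolding field_differentiable_def by blast
  then show "(\<lambda>t. f (a + t *s v)) field_differentiable (at t within {t. a + t *s v \<in> U})"
    by (rule field_differentiable_at_within)
qed

section \<open>Vanishing and identity theorems, and continuity of the derivative\<close>

text \<open>On a complex line through \<open>z\<close> the function is entire and vanishes for large
  parameters, so Liouville's theorem applies.\<close>

lemma holo_on_UNIV_bounded_support_eq_0:
  fixes f :: "complex^'n \<Rightarrow> complex"
  assumes f: "holo_on UNIV f" and B: "bounded B" "\<And>z. z \<notin> B \<Longrightarrow> f z = 0"
  shows "f z = 0"
proof -
  \<comment> \<open>An arbitrary coordinate; the line runs parallel to its axis.\<close>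
  define k where "k = (undefined :: 'n)"
  define v :: "complex^'n" where "v = axis k 1"
  obtain R where R: "\<And>z. z \<in> B \<Longrightarrow> norm z \<le> R" using B(1) by (auto simp: bounded_iff)
  have "f (z + t *s v) = 0" if "norm t > R + norm (z $ k)" for t
  proof -
    have "norm t - norm (z $ k) \<le> norm (z $ k + t)"
      using norm_diff_ineq[of t "z $ k"] by (simp add: add.commute)
    also have "z $ k + t = (z + t *s v) $ k" by (simp add: v_def)
    also have "norm \<dots> \<le> norm (z + t *s v)" by (rule Finite_Cartesian_Product.norm_nth_le)
    finally have "norm (z + t *s v) > R" using that by simp
    then show ?thesis using B(2) R by (meson not_le)
  qed
  then have "\<forall>\<^sub>F t in at_infinity. f (z + t *s v) = 0"
    unfolding eventually_at_infinity by (intro exI[of _ "R + norm (z $ k) + 1"]) auto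
  then have "((\<lambda>t. f (z + t *s v)) \<longlongrightarrow> 0) at_infinity" by (rule tendsto_eventually)
  moreover have "(\<lambda>t. f (z + t *s v)) holomorphic_on UNIV"
    using holomorphic_on_line[OF f] by simp
  ultimately have "f (z + 0 *s v) = 0" by (rule Liouville_weak_0[rotated])
  then show ?thesis by simp
qed

text \<open>Extended by zero, \<open>f\<close> becomes entire with support in \<open>K\<close>. This
  gives uniqueness of extensions on every component of \<open>U\<close> at once.\<close>

lemma holo_on_eq_0_outside_compact:
  fixes f :: "complex^'n \<Rightarrow> complex"
  assumes "holo_on U f" "open U" "compact K" "K \<subseteq> U" "\<And>z. z \<in> U - K \<Longrightarrow> f z = 0" "z \<in> U"
  shows "f z = 0"
proof -
  define g where "g = (\<lambda>z. if z \<in> U then f z else 0)"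
  have "holo_on U g" by (rule holo_on_transform[OF assms(1,2)]) (simp add: g_def)
  moreover have "holo_on (- K) g"
    by (rule holo_on_transform[OF holo_on_const[of _ 0]])
       (use assms compact_imp_closed in \<open>auto simp: g_def\<close>)
  ultimately have "holo_on (U \<union> - K) g" by (rule holo_on_Un)
  also have "U \<union> - K = UNIV" using assms(4) by auto
  finally have "g z = 0"
    by (rule holo_on_UNIV_bounded_support_eq_0[OF _ compact_imp_bounded[OF assms(3)]])
       (use assms(5) in \<open>auto simp: g_def\<close>)
  then show ?thesis using assms(6) by (simp add: g_def)
qed

text \<open>The complex line from a point \<open>a\<close> of \<open>A\<close> to \<open>z\<close>
  meets the ball in a convex set of parameters, on which the identity theorem in one variable
  carries the zeros near \<open>t = 0\<close> to \<open>t = 1\<close>.\<close>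

lemma holo_on_eq_0_ball:
  fixes f :: "complex^'n \<Rightarrow> complex"
  assumes "holo_on (ball c r) f" "open A" "a \<in> A \<inter> ball c r" "\<And>z. z \<in> A \<Longrightarrow> f z = 0" "z \<in> ball c r"
  shows "f z = 0"
proof -
  define T where "T = {t. a + t *s (z - a) \<in> ball c r}"
  define h where "h = (\<lambda>t. f (a + t *s (z - a)))"
  have hol: "h holomorphic_on T" unfolding h_def T_def by (rule holomorphic_on_line[OF assms(1)])
  have opT: "open T" unfolding T_def by (rule open_line_vimage) simp
  have "convex T"
  proof -
    have "linear (\<lambda>t. t *s (z - a))"
      using bounded_linear_vector_smult bounded_linear.linear by blast
    then have "convex ((\<lambda>t. t *s (z - a)) -` ball (c - a) r)"
      by (intro convex_linear_vimage) auto
    moreover have "(\<lambda>t. t *s (z - a)) -` ball (c - a) r = T"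
      by (auto simp: T_def dist_norm algebra_simps)
    ultimately show ?thesis by simp
  qed
  define U where "U = {t. a + t *s (z - a) \<in> A \<inter> ball c r}"
  have opU: "open U" unfolding U_def by (rule open_line_vimage) (use assms in auto)
  have "0 \<in> U" using assms by (auto simp: U_def)
  have "h 1 = 0"
  proof (rule analytic_continuation[OF hol opT])
    show "connected T" using \<open>convex T\<close> by (rule convex_connected)
    show "U \<subseteq> T" by (auto simp: U_def T_def)
    then show "0 \<in> T" using \<open>0 \<in> U\<close> by blast
    show "0 islimpt U" using opU \<open>0 \<in> U\<close> by (intro interior_limit_point) (simp add: interior_open)
    show "h t = 0" if "t \<in> U" for t using that assms(4) by (auto simp: h_def U_def)
    show "1 \<in> T" using assms by (simp add: T_def)
  qed
  then show ?thesis by (simp add: h_def)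
qed

text \<open>The interior of the zero set is also relatively closed: by the ball case, every ball in
  \<open>V\<close> that meets it is contained in it.\<close>

lemma holo_on_identity_theorem:
  fixes f :: "complex^'n \<Rightarrow> complex"
  assumes "holo_on V f" "open V" "connected V" "open A" "A \<noteq> {}" "A \<subseteq> V"
    "\<And>z. z \<in> A \<Longrightarrow> f z = 0" "z \<in> V"
  shows "f z = 0"
proof -
  define Z where "Z = interior {z \<in> V. f z = 0}"
  have Z: "open Z" "Z \<subseteq> V" "\<And>z. z \<in> Z \<Longrightarrow> f z = 0"
    using interior_subset[of "{z \<in> V. f z = 0}"] by (auto simp: Z_def)
  have "A \<subseteq> Z" unfolding Z_def using assms by (intro interior_maximal) auto
  have "open (V - Z)"
  proof (rule openI)
    fix c assume c: "c \<in> V - Z"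
    obtain r where r: "r > 0" "ball c r \<subseteq> V" using c assms(2) openE by blast
    have "Z \<inter> ball c r = {}"
    proof (rule ccontr)
      assume "Z \<inter> ball c r \<noteq> {}"
      then obtain a where "a \<in> Z \<inter> ball c r" by blast
      then have "f z = 0" if "z \<in> ball c r" for z
        using holo_on_eq_0_ball[OF holo_on_subset[OF assms(1) r(2)] Z(1) _ Z(3) that] by blast
      then have "ball c r \<subseteq> Z" unfolding Z_def using r(2) by (intro interior_maximal) auto
      then show False using c r(1) centre_in_ball by blast
    qed
    then show "\<exists>e>0. ball c e \<subseteq> V - Z" using r by blast
  qed
  then have "V - Z = {}"
    using connectedD[OF assms(3) Z(1), of "V - Z"] \<open>A \<subseteq> Z\<close> assms(5) Z(2) by blast
  then show ?thesis using Z(3) assms(8) by blast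
qed

text \<open>Holomorphy is only pointwise differentiability here. Continuity of the derivative
  follows from Cauchy's estimate for the difference of \<open>f\<close> along two parallel lines,
  which uniform continuity of \<open>f\<close> makes small.\<close>

lemma continuous_on_frechet_derivative:
  fixes f :: "complex^'n \<Rightarrow> complex"
  assumes f: "holo_on U f" and "open U"
  shows "continuous_on U (\<lambda>z. frechet_derivative f (at z) v)"
  unfolding continuous_on_iff
proof (intro ballI allI impI)
  fix c and e :: real assume "c \<in> U" "e > 0"
  obtain R where R: "R > 0" "cball c R \<subseteq> U" using assms(2) \<open>c \<in> U\<close> open_contains_cball by blast
  obtain b where b: "b > 0" "\<And>t. norm (t *s v) \<le> norm t * b"
    using bounded_linear.pos_bounded[OF bounded_linear_vector_smult[of v]] by blast
  \<comment> \<open>Parameters up to \<open>r\<close> move a point by at most \<open>R / 2\<close>;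
    with \<open>z\<close> within \<open>R / 2\<close> of \<open>c\<close>, everything stays in
    \<open>cball c R\<close>.\<close>
  define r where "r = R / (2 * b)"
  have r: "r > 0" using R b by (simp add: r_def)
  have close: "norm (t *s v) \<le> R / 2" if "norm t \<le> r" for t
  proof -
    have "norm (t *s v) \<le> r * b" using b that by (meson mult_right_mono less_imp_le order_trans)
    then show ?thesis using b by (simp add: r_def)
  qed
  have "uniformly_continuous_on (cball c R) f"
    by (intro compact_uniformly_continuous continuous_on_subset[OF holo_on_continuous_on[OF f] R(2)]) auto
  \<comment> \<open>Cauchy's estimate divides by the radius \<open>r\<close>, so the tolerance
    \<open>e * r / 2\<close> becomes \<open>e / 2\<close>.\<close>
  then obtain d where d: "d > 0"
      "\<And>x y. x \<in> cball c R \<Longrightarrow> y \<in> cball c R \<Longrightarrow> dist y x < d \<Longrightarrow> dist (f y) (f x) < e * r / 2"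
    unfolding uniformly_continuous_on_def using \<open>e > 0\<close> r
    by (metis half_gt_zero mult_pos_pos)
  show "\<exists>d>0. \<forall>z\<in>U. dist z c < d \<longrightarrow>
      dist (frechet_derivative f (at z) v) (frechet_derivative f (at c) v) < e"
  proof (intro exI[of _ "min d (R / 2)"] conjI ballI impI)
    show "min d (R / 2) > 0" using d R by simp
    fix z assume "z \<in> U" and z: "dist z c < min d (R / 2)"
    have in1: "z + t *s v \<in> cball c R" "c + t *s v \<in> cball c R" if "norm t \<le> r" for t
    proof -
      have "dist c (z + t *s v) \<le> dist c z + norm (t *s v)"
        using dist_triangle[of c "z + t *s v" z] by (simp add: dist_norm)
      then show "z + t *s v \<in> cball c R" using close[OF that] z by (simp add: dist_commute)
      show "c + t *s v \<in> cball c R" using close[OF that] R by (simp add: dist_norm)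
    qed
    define g where "g = (\<lambda>t. f (z + t *s v) - f (c + t *s v))"
    have hol: "g holomorphic_on cball 0 r"
      unfolding g_def
      by (intro holomorphic_on_diff holomorphic_on_subset[OF holomorphic_on_line[OF f]])
         (use in1 R in auto)
    have "norm ((deriv ^^ 1) g 0) \<le> fact 1 * (e * r / 2) / r ^ 1"
    proof (rule Cauchy_inequality[OF _ _ r])
      show "g holomorphic_on ball 0 r" using hol holomorphic_on_subset ball_subset_cball by blast
      show "continuous_on (cball 0 r) g" using hol holomorphic_on_imp_continuous_on by blast
      fix t :: complex assume "norm (0 - t) = r"
      then have "norm t \<le> r" by simp
      have "dist (z + t *s v) (c + t *s v) < d" using z by (simp add: dist_norm)
      from d(2)[OF in1(2,1)[OF \<open>norm t \<le> r\<close>] this]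
      show "norm (g t) \<le> e * r / 2" by (simp add: g_def dist_norm)
    qed
    then have "norm (deriv g 0) \<le> e / 2" using r by simp
    moreover have "deriv g 0 = frechet_derivative f (at z) v - frechet_derivative f (at c) v"
    proof (rule DERIV_imp_deriv)
      show "(g has_field_derivative frechet_derivative f (at z) v - frechet_derivative f (at c) v) (at 0)"
        unfolding g_def
        using DERIV_diff[OF holo_on_line_derivative[OF f, of z 0 v] holo_on_line_derivative[OF f, of c 0 v]]
          \<open>z \<in> U\<close> \<open>c \<in> U\<close> by simp
    qed
    ultimately show "dist (frechet_derivative f (at z) v) (frechet_derivative f (at c) v) < e"
      using \<open>e > 0\<close> by (simp add: dist_norm)
  qed
qed

section \<open>Necessity of connectedness\<close>

lemma bounded_component_obstruction:
  fixes K \<Omega> :: "(complex^'n) set"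
  assumes "open \<Omega>" "compact K" "K \<subseteq> \<Omega>" "\<not> connected (- K)"
  obtains g where "loc_const_on (\<Omega> - K) g" "\<nexists>g'. holo_on \<Omega> g' \<and> (\<forall>z\<in>\<Omega> - K. g' z = g z)"
proof -
  have cl: "closed K" using assms compact_imp_closed by blast
  \<comment> \<open>The real dimension counts: from 2 on, a disconnected complement of a bounded set
    has a bounded component.\<close>
  have "DIM(complex^'n) \<ge> 2" by simp
  then obtain W where W: "W \<in> components (- K)" "bounded W"
    using cobounded_has_bounded_component[of "- K"] assms compact_imp_bounded by auto
  have opW: "open W" using W cl open_components by blast
  have WK: "W \<subseteq> - K" "W \<noteq> {}" using W in_components_subset in_components_nonempty by blast+
  have "open (- K - W)"
  proof -
    obtain T where "closed T" "W = - K \<inter> T"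
      using closedin_component[OF W(1)] by (auto simp: closedin_closed)
    then have "- K - W = - K \<inter> - T" by auto
    then show ?thesis using cl \<open>closed T\<close> by auto
  qed
  define g :: "complex^'n \<Rightarrow> complex" where "g = (\<lambda>z. if z \<in> W then 1 else 0)"
  have "loc_const_on (\<Omega> - K) g"
    unfolding loc_const_on_def
  proof
    fix z assume z: "z \<in> \<Omega> - K"
    consider "z \<in> W" | "z \<in> - K - W" using z by blast
    then show "\<exists>e>0. \<forall>w\<in>ball z e \<inter> (\<Omega> - K). g w = g z"
    proof cases
      case 1
      then obtain e where "e > 0" "ball z e \<subseteq> W" using opW openE by blast
      then show ?thesis using 1 by (intro exI[of _ e]) (auto simp: g_def)
    next
      case 2
      then obtain e where "e > 0" "ball z e \<subseteq> - K - W" using \<open>open (- K - W)\<close> openE by blast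
      then show ?thesis using 2 by (intro exI[of _ e]) (auto simp: g_def)
    qed
  qed
  moreover have False if g': "holo_on \<Omega> g'" "\<forall>z\<in>\<Omega> - K. g' z = g z" for g'
  proof -
    \<comment> \<open>Glues the supposed extension with 1 on \<open>W\<close> and 0 on the other
      components of \<open>- K\<close>. The pieces overlap only in \<open>\<Omega> - K\<close>,
      where they agree, and the result vanishes off the bounded set
      \<open>K \<union> W\<close>.\<close>
    define u where "u = (\<lambda>z. if z \<in> \<Omega> then g' z else if z \<in> W then 1 else 0)"
    have "holo_on \<Omega> u" by (rule holo_on_transform[OF g'(1) assms(1)]) (simp add: u_def)
    moreover have "holo_on W u"
      by (rule holo_on_transform[OF holo_on_const[of _ 1] opW])
         (use WK g'(2) in \<open>auto simp: u_def g_def\<close>)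
    moreover have 0: "u z = 0" if "z \<in> - K - W" for z
      using that g'(2) by (auto simp: u_def g_def)
    moreover have "holo_on (- K - W) u"
      by (rule holo_on_transform[OF holo_on_const[of _ 0] \<open>open (- K - W)\<close> 0])
    ultimately have "holo_on (\<Omega> \<union> W \<union> (- K - W)) u" by (intro holo_on_Un)
    also have "\<Omega> \<union> W \<union> (- K - W) = UNIV" using assms(3) by auto
    finally have "u z = 0" for z
      by (rule holo_on_UNIV_bounded_support_eq_0[where B = "K \<union> W"])
         (use 0 W(2) assms(2) compact_imp_bounded in auto)
    moreover obtain w where "w \<in> W" using WK by blast
    then have "u w = 1" using WK g'(2) by (auto simp: u_def g_def)
    ultimately show False by simp
  qed
  ultimately show thesis using that by blast
qed

subsection \<open>Cauchy kernel integrals along one coordinate\<close>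

text \<open>Differentiation under the integral sign. The integrand \<open>h\<close> is controlled
  only on the neighbourhood \<open>W\<close> of \<open>B \<times> T\<close>, and the factor
  \<open>G\<close>, zero off \<open>T\<close>, extends the product by zero to all
  \<open>\<zeta>\<close>.\<close>

lemma holo_on_parameter_integral:
  fixes h :: "complex^'n \<Rightarrow> complex \<Rightarrow> complex"
  assumes B: "open B" "convex B" and T: "compact T" and W: "open W" "B \<times> T \<subseteq> W"
    and G: "continuous_on UNIV G" "\<And>\<zeta>. \<zeta> \<notin> T \<Longrightarrow> G \<zeta> = 0"
    and der: "\<And>z \<zeta>. (z, \<zeta>) \<in> W \<Longrightarrow> ((\<lambda>z. h z \<zeta>) has_derivative D z \<zeta>) (at z)"
    and lin: "\<And>z \<zeta> c x. (z, \<zeta>) \<in> W \<Longrightarrow> D z \<zeta> (c *s x) = c * D z \<zeta> x"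
    and contD: "\<And>x. continuous_on W (\<lambda>(z, \<zeta>). D z \<zeta> x)"
    and conth: "continuous_on W (\<lambda>(z, \<zeta>). h z \<zeta>)"
  shows "holo_on B (\<lambda>z. integral UNIV (\<lambda>\<zeta>. G \<zeta> * h z \<zeta>))"
proof -
  obtain a b where ab: "T \<subseteq> cbox a b"
    using bounded_subset_cbox_symmetric[OF compact_imp_bounded[OF T]] by metis
  have clT: "closed T" using T by (rule compact_imp_closed)
  have cover: "continuous_on (B \<times> UNIV) (\<lambda>(z, \<zeta>). G \<zeta> * k z \<zeta>)"
    if k: "continuous_on W (\<lambda>(z, \<zeta>). k z \<zeta>)" for k :: "complex^'n \<Rightarrow> complex \<Rightarrow> complex"
  proof -
    have "continuous_on W (\<lambda>(z, \<zeta>). G \<zeta> * k z \<zeta>)"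
      using k unfolding case_prod_beta
      by (intro continuous_on_mult continuous_on_compose2[OF G(1)] continuous_intros) auto
    moreover have "continuous_on (UNIV \<times> - T) (\<lambda>(z, \<zeta>). G \<zeta> * k z \<zeta>)"
    proof -
      have "continuous_on (UNIV \<times> - T) (\<lambda>p :: (complex^'n) \<times> complex. 0 :: complex)" by simp
      then show ?thesis by (rule continuous_on_eq) (use G(2) in auto)
    qed
    moreover have "open (UNIV \<times> - T :: ((complex^'n) \<times> complex) set)"
      using clT by (intro open_Times) auto
    ultimately have "continuous_on (W \<union> UNIV \<times> - T) (\<lambda>(z, \<zeta>). G \<zeta> * k z \<zeta>)"
      using W(1) by (intro continuous_on_open_Un)
    then show ?thesis by (rule continuous_on_subset) (use W(2) in auto)
  qed
  have slice: "continuous_on UNIV (\<lambda>\<zeta>. G \<zeta> * h z \<zeta>)" if "z \<in> B" for z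
    using continuous_on_compose2[OF cover[OF conth] continuous_on_Pair[OF continuous_on_const[of _ z]
          continuous_on_id], of UNIV] that
    by auto
  have int_eq: "integral UNIV (\<lambda>\<zeta>. G \<zeta> * h z \<zeta>) = integral (cbox a b) (\<lambda>\<zeta>. G \<zeta> * h z \<zeta>)"
    if "z \<in> B" for z
    using has_integral_compact_support[OF slice[OF that] _ ab] G(2) by (simp add: integral_unique)
  \<comment> \<open>The Leibniz rule takes the derivative as an operator-valued function. For
    \<open>\<zeta>\<close> off \<open>T\<close> the factor \<open>G \<zeta>\<close> makes it the
    zero operator, even where \<open>D z \<zeta>\<close> is not linear.\<close>
  define F where "F = (\<lambda>z \<zeta>. Blinfun (\<lambda>x. G \<zeta> * D z \<zeta> x))"
  have F: "blinfun_apply (F z \<zeta>) = (\<lambda>x. G \<zeta> * D z \<zeta> x)" if "z \<in> B" for z \<zeta>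
  proof (cases "\<zeta> \<in> T")
    case True
    then have "bounded_linear (D z \<zeta>)"
      using der W(2) that has_derivative_bounded_linear by blast
    then show ?thesis unfolding F_def
      by (intro bounded_linear_Blinfun_apply bounded_linear_const_mult)
  next
    case False
    then show ?thesis unfolding F_def using G(2)
      by (intro bounded_linear_Blinfun_apply) simp
  qed
  have contF: "continuous_on (B \<times> UNIV) (\<lambda>(z, \<zeta>). F z \<zeta>)"
  proof (rule continuous_on_blinfun_componentwise)
    fix x :: "complex^'n"
    show "continuous_on (B \<times> UNIV) (\<lambda>p. blinfun_apply (case p of (z, \<zeta>) \<Rightarrow> F z \<zeta>) x)"
      by (rule continuous_on_eq[OF cover[OF contD[of x]]]) (auto simp: F)
  qed
  show ?thesis
    unfolding holo_on_def
  proof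
    fix z0 assume z0: "z0 \<in> B"
    have "((\<lambda>z. integral (cbox a b) (\<lambda>\<zeta>. G \<zeta> * h z \<zeta>)) has_derivative
        blinfun_apply (integral (cbox a b) (F z0))) (at z0 within B)"
    proof (rule leibniz_rule[OF _ _ _ z0 B(2)])
      fix z \<zeta> assume z: "z \<in> B"
      show "((\<lambda>z. G \<zeta> * h z \<zeta>) has_derivative blinfun_apply (F z \<zeta>)) (at z within B)"
      proof (cases "\<zeta> \<in> T")
        case True
        then have "(z, \<zeta>) \<in> W" using W(2) z by auto
        then show ?thesis unfolding F[OF z]
          by (rule has_derivative_mult_right[OF has_derivative_at_withinI[OF der]])
      next
        case False
        then show ?thesis unfolding F[OF z] using G(2) by simp
      qed
      show "(\<lambda>\<zeta>. G \<zeta> * h z \<zeta>) integrable_on cbox a b"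
        by (rule integrable_continuous[OF continuous_on_subset[OF slice[OF z]]]) simp
    next
      show "continuous_on (B \<times> cbox a b) (\<lambda>(z, \<zeta>). F z \<zeta>)"
        by (rule continuous_on_subset[OF contF]) auto
    qed
    then have "((\<lambda>z. integral (cbox a b) (\<lambda>\<zeta>. G \<zeta> * h z \<zeta>)) has_derivative
        blinfun_apply (integral (cbox a b) (F z0))) (at z0)"
      using at_within_open[OF z0 B(1)] by simp
    then have 1: "((\<lambda>z. integral UNIV (\<lambda>\<zeta>. G \<zeta> * h z \<zeta>)) has_derivative
        blinfun_apply (integral (cbox a b) (F z0))) (at z0)"
      by (rule has_derivative_transform_within_open[OF _ B(1) z0]) (simp add: int_eq)
    have "F z0 integrable_on cbox a b"
      using continuous_on_compose2[OF contF continuous_on_Pair[OF continuous_on_const[of _ z0]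
            continuous_on_id], of "cbox a b"] z0
      by (intro integrable_continuous) auto
    then have 2: "blinfun_apply (integral (cbox a b) (F z0)) x
        = integral (cbox a b) (\<lambda>\<zeta>. G \<zeta> * D z0 \<zeta> x)" for x
      by (simp add: blinfun_apply_integral F[OF z0])
    have 3: "G \<zeta> * D z0 \<zeta> (c *s x) = c * (G \<zeta> * D z0 \<zeta> x)" for c x \<zeta>
      using lin[of z0 \<zeta> c x] G(2)[of \<zeta>] W(2) z0 by (cases "\<zeta> \<in> T") auto
    show "\<exists>L. ((\<lambda>z. integral UNIV (\<lambda>\<zeta>. G \<zeta> * h z \<zeta>)) has_derivative L) (at z0) \<and>
        (\<forall>c x. L (c *s x) = c * L x)"
      using 1 by (intro exI conjI, assumption)
        (simp only: 2 3 Henstock_Kurzweil_Integration.integral_mult_right simp_thms)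
  qed
qed

section \<open>Coordinate slices and the Cauchy kernel on them\<close>

definition upd :: "'n \<Rightarrow> complex^'n \<Rightarrow> complex \<Rightarrow> complex^'n" where
  "upd i z w = (\<chi> k. if k = i then w else z $ k)"

lemma upd_nth: "upd i z w $ k = (if k = i then w else z $ k)"
  by (simp add: upd_def)

lemma upd_self: "upd i z (z $ i) = z"
  by (simp add: vec_eq_iff upd_nth)

text \<open>Exhibits a coordinate slice as a complex line, so that the results on lines apply to
  slices.\<close>

lemma upd_line: "upd i z w = upd i z 0 + w *s axis i 1"
  by (simp add: vec_eq_iff upd_nth axis_def)

lemma dist_upd_le: "dist (upd i z w) (upd i z' w) \<le> dist z z'"
  unfolding dist_norm by (rule norm_le_componentwise_cart) (simp add: upd_nth)

lemma continuous_on_upd: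
  "continuous_on S a \<Longrightarrow> continuous_on S b \<Longrightarrow> continuous_on S (\<lambda>x. upd i (a x) (b x))"
  unfolding upd_def
proof (rule continuous_on_vec_lambda)
  fix k assume "continuous_on S a" "continuous_on S b"
  then show "continuous_on S (\<lambda>x. if k = i then b x else a x $ k)"
    by (cases "k = i") (auto intro: continuous_on_component)
qed

lemma bounded_linear_upd_0: "bounded_linear (\<lambda>x. upd i x 0)"
  unfolding linear_conv_bounded_linear[symmetric]
  by (rule linearI) (auto simp: vec_eq_iff upd_nth)

lemma has_derivative_upd: "((\<lambda>z. upd i z w) has_derivative (\<lambda>x. upd i x 0)) (at z)"
  using has_derivative_add[OF bounded_linear_imp_has_derivative[OF bounded_linear_upd_0[of i]]
      has_derivative_const[of "w *s axis i 1"], of "at z"]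
  by (simp flip: upd_line)

lemma open_upd_vimage: "open U \<Longrightarrow> open {\<zeta>. upd i z \<zeta> \<in> U}"
  using open_vimage[of U "upd i z"] continuous_on_upd[of UNIV "\<lambda>_. z" "\<lambda>w. w" i]
  by (simp add: vimage_def continuous_on_id)

lemma compact_upd_vimage:
  assumes "compact K"
  shows "compact {\<zeta>. upd i z \<zeta> \<in> K}"
proof -
  have "closed {\<zeta>. upd i z \<zeta> \<in> K}"
    using open_upd_vimage[of "- K" i z] compact_imp_closed[OF assms]
    by (simp add: closed_def Collect_neg_eq[symmetric])
  moreover have "{\<zeta>. upd i z \<zeta> \<in> K} \<subseteq> (\<lambda>x. x $ i) ` K"
    by (auto simp: upd_nth intro!: image_eqI[where x = "upd i z _"])
  then have "bounded {\<zeta>. upd i z \<zeta> \<in> K}"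
    using bounded_subset bounded_linear_image[OF compact_imp_bounded[OF assms] bounded_linear_vec_nth]
    by blast
  ultimately show ?thesis by (simp add: compact_eq_bounded_closed)
qed

lemma holomorphic_on_upd:
  assumes "holo_on U f"
  shows "(\<lambda>\<zeta>. f (upd i z \<zeta>)) holomorphic_on {\<zeta>. upd i z \<zeta> \<in> U}"
  using holomorphic_on_line[OF assms, of "upd i z 0" "axis i 1"] by (simp flip: upd_line)

lemma holo_on_Cauchy_kernel_integral:
  fixes f :: "complex^'n \<Rightarrow> complex"
  assumes f: "holo_on V f" "open V" and B: "open B" "convex B" and T: "compact T"
    and BT: "\<And>z \<zeta>. z \<in> B \<Longrightarrow> \<zeta> \<in> T \<Longrightarrow> upd i z \<zeta> \<in> V \<and> \<zeta> \<noteq> z $ i"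
    and G: "continuous_on UNIV G" "\<And>\<zeta>. \<zeta> \<notin> T \<Longrightarrow> G \<zeta> = 0"
  shows "holo_on B (\<lambda>z. integral UNIV (\<lambda>\<zeta>. G \<zeta> * (f (upd i z \<zeta>) / (\<zeta> - z $ i))))"
proof -
  define W where "W = {p. upd i (fst p) (snd p) \<in> V \<and> snd p \<noteq> fst p $ i}"
  \<comment> \<open>The quotient rule: moving \<open>z\<close> along \<open>x\<close> moves
    \<open>upd i z \<zeta>\<close> along \<open>upd i x 0\<close>, while the \<open>i\<close>-th
    component of \<open>x\<close> acts only through the denominator.\<close>
  define D where "D = (\<lambda>z \<zeta> x. frechet_derivative f (at (upd i z \<zeta>)) (upd i x 0) / (\<zeta> - z $ i)
      + f (upd i z \<zeta>) * (x $ i) / (\<zeta> - z $ i)\<^sup>2)"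
  have contu: "continuous_on S (\<lambda>p. upd i (fst p) (snd p))" for S
    by (intro continuous_on_upd continuous_intros)
  have contn: "continuous_on S (\<lambda>p :: (complex^'n) \<times> complex. fst p $ i)" for S
    by (intro continuous_intros)
  have "open W"
  proof -
    have "open ((\<lambda>p. upd i (fst p) (snd p)) -` V)" by (rule open_vimage[OF f(2) contu])
    moreover have "open {p :: (complex^'n) \<times> complex. snd p \<noteq> fst p $ i}"
      by (intro open_Collect_neq contn continuous_intros)
    moreover have "W = (\<lambda>p. upd i (fst p) (snd p)) -` V \<inter> {p. snd p \<noteq> fst p $ i}"
      by (auto simp: W_def)
    ultimately show ?thesis by auto
  qed
  show ?thesis
  proof (rule holo_on_parameter_integral[OF B T \<open>open W\<close> _ G, where D = D])
    show "B \<times> T \<subseteq> W" using BT by (auto simp: W_def)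
    show "continuous_on W (\<lambda>(z, \<zeta>). f (upd i z \<zeta>) / (\<zeta> - z $ i))"
      unfolding case_prod_beta
      by (intro continuous_intros contn continuous_on_compose2[OF holo_on_continuous_on[OF f(1)] contu])
         (auto simp: W_def)
    show "continuous_on W (\<lambda>(z, \<zeta>). D z \<zeta> x)" for x
      unfolding case_prod_beta D_def
      by (intro continuous_intros contn continuous_on_compose2[OF holo_on_continuous_on[OF f(1)] contu]
          continuous_on_compose2[OF continuous_on_frechet_derivative[OF f] contu])
         (auto simp: W_def)
    fix z \<zeta> assume "(z, \<zeta>) \<in> W"
    then have z: "upd i z \<zeta> \<in> V" "\<zeta> - z $ i \<noteq> 0" by (auto simp: W_def)
    have 1: "((\<lambda>z. f (upd i z \<zeta>)) has_derivative
        (\<lambda>x. frechet_derivative f (at (upd i z \<zeta>)) (upd i x 0))) (at z)"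
      by (rule has_derivative_compose[OF has_derivative_upd holo_on_frechet_derivative(1)[OF f(1) z(1)]])
    have 2: "((\<lambda>z. \<zeta> - z $ i) has_derivative (\<lambda>x. - (x $ i))) (at z)"
      using has_derivative_diff[OF has_derivative_const[of \<zeta>]
          bounded_linear_imp_has_derivative[OF bounded_linear_vec_nth]] by simp
    have 3: "(a * d - b * - c) / (d * d) = a / d + b * c / d\<^sup>2" if "d \<noteq> 0" for a b c d :: complex
      using that by (simp add: power2_eq_square add_divide_distrib)
    show "((\<lambda>z. f (upd i z \<zeta>) / (\<zeta> - z $ i)) has_derivative D z \<zeta>) (at z)"
      by (rule has_derivative_eq_rhs[OF has_derivative_divide'[OF 1 2 z(2)]])
         (simp only: D_def 3[OF z(2)])
    fix c x
    have "upd i (c *s x) 0 = c *s upd i x 0" by (simp add: vec_eq_iff upd_nth)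
    then show "D z \<zeta> (c *s x) = c * D z \<zeta> x"
      by (simp add: D_def holo_on_frechet_derivative(2)[OF f(1) z(1)] distrib_left)
  qed
qed

subsection \<open>Hartogs extension\<close>

lemma holo_on_local:
  assumes "\<And>z. z \<in> U \<Longrightarrow> \<exists>B. z \<in> B \<and> holo_on B f"
  shows "holo_on U f"
  using assms unfolding holo_on_def by blast

lemma holo_on_scale: "holo_on U g \<Longrightarrow> holo_on U (\<lambda>z. g z / c)"
  using holo_on_mult[OF _ holo_on_const[of U "inverse c"], of g] by (simp add: divide_inverse)

text \<open>The points of \<open>K\<close> whose \<open>i\<close>-th coordinate lies outside
  \<open>N\<close> form a compact set. None of them agrees with \<open>z0\<close> in all other
  coordinates, so they keep a positive distance from the slice through \<open>z0\<close>.\<close>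

lemma upd_slice_near:
  fixes K :: "(complex^'n) set"
  assumes "compact K" "open N" "{\<zeta>. upd i z0 \<zeta> \<in> K} \<subseteq> N"
  obtains d where "d > 0" "\<And>z. z \<in> ball z0 d \<Longrightarrow> {\<zeta>. upd i z \<zeta> \<in> K} \<subseteq> N"
proof -
  define K' where "K' = K \<inter> (\<lambda>x. x $ i) -` (- N)"
  have "closed ((\<lambda>x :: complex^'n. x $ i) -` (- N))"
    using assms(2) by (intro closed_vimage continuous_intros) auto
  then have "compact K'" unfolding K'_def using assms(1) by (intro compact_Int_closed)
  have pos: "dist (upd i k 0) (upd i z0 0) > 0" if k: "k \<in> K'" for k
  proof (rule ccontr)
    assume "\<not> ?thesis"
    then have "upd i k 0 = upd i z0 0" by simp
    then have "upd i z0 (k $ i) = k"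
      by (metis upd_line upd_self)
    then have "k $ i \<in> {\<zeta>. upd i z0 \<zeta> \<in> K}" using k by (simp add: K'_def)
    then show False using k assms(3) by (auto simp: K'_def)
  qed
  have "\<exists>d>0. \<forall>k\<in>K'. d \<le> dist (upd i k 0) (upd i z0 0)"
  proof (cases "K' = {}")
    case False
    have "continuous_on K' (\<lambda>k. dist (upd i k 0) (upd i z0 0))"
      by (intro continuous_on_dist continuous_on_upd continuous_on_const continuous_on_id)
    then obtain x where "x \<in> K'"
        "\<And>k. k \<in> K' \<Longrightarrow> dist (upd i x 0) (upd i z0 0) \<le> dist (upd i k 0) (upd i z0 0)"
      using continuous_attains_inf[OF \<open>compact K'\<close> False] by metis
    then show ?thesis using pos by blast
  qed (auto intro: exI[of _ 1])
  then obtain d where d: "d > 0" "\<And>k. k \<in> K' \<Longrightarrow> d \<le> dist (upd i k 0) (upd i z0 0)" by blast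
  show thesis
  proof (rule that[OF d(1)], rule subsetI, rule ccontr)
    fix z \<zeta> assume z: "z \<in> ball z0 d" and "\<zeta> \<in> {\<zeta>. upd i z \<zeta> \<in> K}" "\<zeta> \<notin> N"
    then have "upd i z \<zeta> \<in> K'" by (simp add: K'_def upd_nth)
    from d(2)[OF this] have "d \<le> dist (upd i (upd i z \<zeta>) 0) (upd i z0 0)" .
    also have "upd i (upd i z \<zeta>) 0 = upd i z 0" by (simp add: vec_eq_iff upd_nth)
    also have "dist (upd i z 0) (upd i z0 0) \<le> dist z z0" by (rule dist_upd_le)
    finally show False using z by (simp add: dist_commute)
  qed
qed

text \<open>The compact copy of \<open>S\<close> in the slice through \<open>z0\<close> has a
  uniform margin inside \<open>U\<close>, and passing to the slice through \<open>z\<close>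
  displaces its points by at most \<open>dist z0 z\<close>.\<close>

lemma upd_compact_near:
  fixes U :: "(complex^'n) set"
  assumes "compact S" "open U" "S \<subseteq> {\<zeta>. upd i z0 \<zeta> \<in> U}"
  obtains d where "d > 0" "\<And>z. z \<in> ball z0 d \<Longrightarrow> S \<subseteq> {\<zeta>. upd i z \<zeta> \<in> U}"
proof -
  have "compact (upd i z0 ` S)"
    by (intro compact_continuous_image continuous_on_upd continuous_on_const continuous_on_id assms(1))
  moreover have "upd i z0 ` S \<subseteq> U" using assms(3) by auto
  ultimately obtain d where d: "d > 0" "(\<Union>x\<in>upd i z0 ` S. ball x d) \<subseteq> U"
    using compact_subset_open_imp_ball_epsilon_subset[OF _ assms(2)] by metis
  show thesis
  proof (rule that[OF d(1)], rule subsetI)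
    fix z \<zeta> assume z: "z \<in> ball z0 d" and "\<zeta> \<in> S"
    have "dist (upd i z0 \<zeta>) (upd i z \<zeta>) \<le> dist z0 z" by (rule dist_upd_le)
    then have "upd i z \<zeta> \<in> ball (upd i z0 \<zeta>) d" using z by simp
    then show "\<zeta> \<in> {\<zeta>. upd i z \<zeta> \<in> U}" using d(2) \<open>\<zeta> \<in> S\<close> by blast
  qed
qed

section \<open>The Cauchy integrals over slices and their difference\<close>

locale hartogs =
  fixes \<Omega> K :: "(complex^'n) set" and f :: "complex^'n \<Rightarrow> complex" and i :: 'n
  assumes \<Omega>: "open \<Omega>" and K: "compact K" "K \<subseteq> \<Omega>" and f: "holo_on (\<Omega> - K) f"
begin

definition \<Omega>s where "\<Omega>s z = {\<zeta>. upd i z \<zeta> \<in> \<Omega>}"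
definition Ks where "Ks z = {\<zeta>. upd i z \<zeta> \<in> K}"
definition cauchy_kernel where "cauchy_kernel z \<zeta> = f (upd i z \<zeta>) / (\<zeta> - z $ i)"

text \<open>Up to \<open>cauchy_const\<close>, \<open>ext z\<close> is the Cauchy integral of the slice of \<open>f\<close> through \<open>z\<close> over a cycle
  around both \<open>K\<close> and \<open>z $ i\<close>, and \<open>jump z\<close> the one over a cycle around \<open>K\<close> but not \<open>z $ i\<close>; the latter
  makes sense on all of \<open>- K\<close>, also outside \<open>\<Omega>\<close>.\<close>

definition ext where
  "ext z = cutoff_integral (insert (z $ i) (Ks z)) (\<Omega>s z) (cauchy_kernel z) / cauchy_const"

definition jump where
  "jump z = cutoff_integral (Ks z) (\<Omega>s z - {z $ i}) (cauchy_kernel z) / cauchy_const"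

lemma slices: "open (\<Omega>s z)" "compact (Ks z)" "closed (Ks z)" "Ks z \<subseteq> \<Omega>s z"
  unfolding \<Omega>s_def Ks_def
  using open_upd_vimage[OF \<Omega>] compact_upd_vimage[OF K(1)]
    compact_imp_closed[OF compact_upd_vimage[OF K(1)]] K(2) by auto

lemma slice_mem: "z $ i \<in> \<Omega>s z \<longleftrightarrow> z \<in> \<Omega>" "z $ i \<in> Ks z \<longleftrightarrow> z \<in> K"
  by (simp_all add: \<Omega>s_def Ks_def upd_self)

lemma f_slice: "(\<lambda>\<zeta>. f (upd i z \<zeta>)) holomorphic_on \<Omega>s z - Ks z"
  by (rule holomorphic_on_subset[OF holomorphic_on_upd[OF f]]) (auto simp: \<Omega>s_def Ks_def)

lemma cauchy_kernel_holomorphic: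
  assumes "V \<subseteq> \<Omega>s z - Ks z - {z $ i}"
  shows "cauchy_kernel z holomorphic_on V"
  unfolding cauchy_kernel_def
  using assms by (intro holomorphic_intros holomorphic_on_subset[OF f_slice]) auto

lemma open_diff: "open (\<Omega> - K)"
  using \<Omega> K compact_imp_closed by blast

text \<open>One cutoff function serves for all \<open>z\<close> near \<open>z0\<close>, which makes
  the integral holomorphic in \<open>z\<close>. The set \<open>Q\<close> keeps the pole
  \<open>z $ i\<close> off \<open>S - N\<close>, where \<open>G\<close> is supported: inside
  \<open>N\<close> in the case of \<open>ext\<close>, outside \<open>S\<close> in the case of
  \<open>jump\<close>.\<close>

lemma cutoff_family:
  assumes G: "has_gradient \<phi> G" and NS: "open N" "compact S" "Ks z0 \<subseteq> N" "S \<subseteq> \<Omega>s z0"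
      "\<And>\<zeta>. \<zeta> \<in> N \<Longrightarrow> \<phi> \<zeta> = 1" "\<And>\<zeta>. \<zeta> \<notin> S \<Longrightarrow> \<phi> \<zeta> = 0"
    and Q: "open Q" "z0 \<in> Q" "\<And>z. z \<in> Q \<Longrightarrow> z $ i \<notin> S - N"
  obtains d where "d > 0" "ball z0 d \<subseteq> Q" "\<And>z. z \<in> ball z0 d \<Longrightarrow> Ks z \<subseteq> N \<and> S \<subseteq> \<Omega>s z"
    "holo_on (ball z0 d) (\<lambda>z. integral UNIV (\<lambda>\<zeta>. G \<zeta> * cauchy_kernel z \<zeta>))"
proof -
  obtain d1 where d1: "d1 > 0" "\<And>z. z \<in> ball z0 d1 \<Longrightarrow> Ks z \<subseteq> N"
    using upd_slice_near[OF K(1) NS(1), of i z0] NS(3) unfolding Ks_def by metis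
  obtain d2 where d2: "d2 > 0" "\<And>z. z \<in> ball z0 d2 \<Longrightarrow> S \<subseteq> \<Omega>s z"
    using upd_compact_near[OF NS(2) \<Omega>, of i z0] NS(4) unfolding \<Omega>s_def by metis
  obtain d3 where d3: "d3 > 0" "ball z0 d3 \<subseteq> Q" using Q openE by blast
  define d where "d = min d1 (min d2 d3)"
  have d: "d > 0" "ball z0 d \<subseteq> Q" "\<And>z. z \<in> ball z0 d \<Longrightarrow> Ks z \<subseteq> N \<and> S \<subseteq> \<Omega>s z"
    using d1 d2 d3 by (auto simp: d_def)
  have "holo_on (ball z0 d) (\<lambda>z. integral UNIV (\<lambda>\<zeta>. G \<zeta> * cauchy_kernel z \<zeta>))"
    unfolding cauchy_kernel_def
  proof (rule holo_on_Cauchy_kernel_integral[OF f open_diff])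
    show "compact (S - N)" using NS by (intro compact_diff)
    fix z \<zeta> assume z: "z \<in> ball z0 d" and \<zeta>: "\<zeta> \<in> S - N"
    have "\<zeta> \<in> \<Omega>s z" "\<zeta> \<notin> Ks z" using d(3)[OF z] \<zeta> by auto
    moreover have "z $ i \<notin> S - N" using Q(3) d(2) z by blast
    then have "\<zeta> \<noteq> z $ i" using \<zeta> by blast
    ultimately show "upd i z \<zeta> \<in> \<Omega> - K \<and> \<zeta> \<noteq> z $ i" by (simp add: \<Omega>s_def Ks_def)
  next
    show "continuous_on UNIV G" using G by (simp add: has_gradient_def)
    show "G \<zeta> = 0" if "\<zeta> \<notin> S - N" for \<zeta>
      by (rule plateau_gradient_eq_0[OF G NS(1,2,5,6) that])
  qed auto
  then show thesis using that d by blast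
qed

lemma ext_holo: "holo_on \<Omega> ext"
proof (rule holo_on_local)
  fix z0 assume z0: "z0 \<in> \<Omega>"
  obtain \<phi> G where p: "plateau (insert (z0 $ i) (Ks z0)) (\<Omega>s z0) \<phi> G"
    using plateau_exists[of "insert (z0 $ i) (Ks z0)" "\<Omega>s z0"] slices[of z0] slice_mem(1)[of z0] z0
    by (metis compact_insert insert_subset)
  then obtain N S where NS: "open N" "insert (z0 $ i) (Ks z0) \<subseteq> N" "compact S" "S \<subseteq> \<Omega>s z0"
      "\<And>\<zeta>. \<zeta> \<in> N \<Longrightarrow> \<phi> \<zeta> = 1" "\<And>\<zeta>. \<zeta> \<notin> S \<Longrightarrow> \<phi> \<zeta> = 0" and G: "has_gradient \<phi> G"
    unfolding plateau_def by auto
  define Q where "Q = (\<lambda>z :: complex^'n. z $ i) -` N"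
  have Q: "open Q" "z0 \<in> Q" "\<And>z. z \<in> Q \<Longrightarrow> z $ i \<notin> S - N"
    unfolding Q_def using NS by (auto intro!: open_vimage continuous_intros)
  obtain d where d: "d > 0" "ball z0 d \<subseteq> Q" "\<And>z. z \<in> ball z0 d \<Longrightarrow> Ks z \<subseteq> N \<and> S \<subseteq> \<Omega>s z"
      "holo_on (ball z0 d) (\<lambda>z. integral UNIV (\<lambda>\<zeta>. G \<zeta> * cauchy_kernel z \<zeta>))"
    using cutoff_family[OF G NS(1,3) _ NS(4,5,6) Q] NS(2) by (metis insert_subset)
  have "ext z = integral UNIV (\<lambda>\<zeta>. G \<zeta> * cauchy_kernel z \<zeta>) / cauchy_const" if z: "z \<in> ball z0 d" for z
  proof -
    have "plateau (insert (z $ i) (Ks z)) (\<Omega>s z) \<phi> G"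
      unfolding plateau_def
    proof (intro conjI G exI)
      show "open N" "compact S" "\<forall>\<zeta>\<in>N. \<phi> \<zeta> = 1" "\<forall>\<zeta>. \<zeta> \<notin> S \<longrightarrow> \<phi> \<zeta> = 0" using NS by auto
      show "insert (z $ i) (Ks z) \<subseteq> N" "S \<subseteq> \<Omega>s z" using d(2) d(3)[OF z] z by (auto simp: Q_def)
    qed
    then show ?thesis
      unfolding ext_def
      by (subst cutoff_integral_eq[OF _ slices(1)])
         (auto intro!: cauchy_kernel_holomorphic closed_insert slices)
  qed
  then have "holo_on (ball z0 d) ext"
    by (intro holo_on_transform[OF holo_on_scale[OF d(4)]]) auto
  then show "\<exists>B. z0 \<in> B \<and> holo_on B ext" using d(1) centre_in_ball by blast
qed

lemma jump_holo: "holo_on (- K) jump"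
proof (rule holo_on_local)
  fix z0 assume z0: "z0 \<in> - K"
  have op: "open (\<Omega>s z - {z $ i})" for z using slices(1) by (intro open_Diff) auto
  have "Ks z0 \<subseteq> \<Omega>s z0 - {z0 $ i}" using slices(4)[of z0] slice_mem(2)[of z0] z0 by auto
  then obtain \<phi> G where p: "plateau (Ks z0) (\<Omega>s z0 - {z0 $ i}) \<phi> G"
    using plateau_exists[OF slices(2) op] by metis
  then obtain N S where NS: "open N" "Ks z0 \<subseteq> N" "compact S" "S \<subseteq> \<Omega>s z0 - {z0 $ i}"
      "\<And>\<zeta>. \<zeta> \<in> N \<Longrightarrow> \<phi> \<zeta> = 1" "\<And>\<zeta>. \<zeta> \<notin> S \<Longrightarrow> \<phi> \<zeta> = 0" and G: "has_gradient \<phi> G"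
    unfolding plateau_def by auto
  have NS4: "S \<subseteq> \<Omega>s z0" using NS(4) by blast
  define Q where "Q = (\<lambda>z :: complex^'n. z $ i) -` (- S)"
  have Q: "open Q" "z0 \<in> Q" "\<And>z. z \<in> Q \<Longrightarrow> z $ i \<notin> S - N"
    unfolding Q_def using NS compact_imp_closed[OF NS(3)]
    by (auto intro!: open_vimage continuous_intros)
  obtain d where d: "d > 0" "ball z0 d \<subseteq> Q" "\<And>z. z \<in> ball z0 d \<Longrightarrow> Ks z \<subseteq> N \<and> S \<subseteq> \<Omega>s z"
      "holo_on (ball z0 d) (\<lambda>z. integral UNIV (\<lambda>\<zeta>. G \<zeta> * cauchy_kernel z \<zeta>))"
    using cutoff_family[OF G NS(1,3,2) NS4 NS(5,6) Q] by metis
  have "jump z = integral UNIV (\<lambda>\<zeta>. G \<zeta> * cauchy_kernel z \<zeta>) / cauchy_const" if z: "z \<in> ball z0 d" for z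
  proof -
    have "plateau (Ks z) (\<Omega>s z - {z $ i}) \<phi> G"
      unfolding plateau_def
    proof (intro conjI G exI)
      show "open N" "compact S" "\<forall>\<zeta>\<in>N. \<phi> \<zeta> = 1" "\<forall>\<zeta>. \<zeta> \<notin> S \<longrightarrow> \<phi> \<zeta> = 0" using NS by auto
      show "Ks z \<subseteq> N" "S \<subseteq> \<Omega>s z - {z $ i}" using d(2) d(3)[OF z] z by (auto simp: Q_def)
    qed
    then show ?thesis
      unfolding jump_def
      by (subst cutoff_integral_eq[OF _ op slices(3)]) (auto intro!: cauchy_kernel_holomorphic)
  qed
  then have "holo_on (ball z0 d) jump"
    by (intro holo_on_transform[OF holo_on_scale[OF d(4)]]) auto
  then show "\<exists>B. z0 \<in> B \<and> holo_on B jump" using d(1) centre_in_ball by blast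
qed

text \<open>A small disc separates the pole from the slice of \<open>K\<close>. The cycle around
  both then splits in two, and the part around the pole gives \<open>f z\<close> by Cauchy's
  formula.\<close>

lemma ext_eq:
  assumes z: "z \<in> \<Omega> - K"
  shows "ext z = jump z + f z"
proof -
  have "open (\<Omega>s z - Ks z)" "z $ i \<in> \<Omega>s z - Ks z"
    using slices[of z] slice_mem[of z] z by (auto intro: open_Diff)
  then obtain r where r: "r > 0" "cball (z $ i) r \<subseteq> \<Omega>s z - Ks z"
    using open_contains_cball by blast
  \<comment> \<open>Removing the closed disc leaves an open set disjoint from the open disc
    \<open>U2\<close>; shrinking the surroundings in this way preserves the integrals.\<close>
  define U1 where "U1 = \<Omega>s z - cball (z $ i) r"
  define U2 where "U2 = ball (z $ i) r"
  have U1: "open U1" "Ks z \<subseteq> U1" "U1 \<subseteq> \<Omega>s z - {z $ i}"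
    unfolding U1_def using slices[of z] r by (auto intro: open_Diff)
  have U2: "open U2" "z $ i \<in> U2" "U2 \<subseteq> \<Omega>s z - Ks z" "U1 \<inter> U2 = {}"
    unfolding U1_def U2_def using r(1) order_trans[OF ball_subset_cball r(2)] by auto
  have "cutoff_integral (insert (z $ i) (Ks z)) (\<Omega>s z) (cauchy_kernel z)
      = cutoff_integral (Ks z \<union> {z $ i}) (U1 \<union> U2) (cauchy_kernel z)"
  proof (rule cutoff_integral_mono[symmetric])
    show "cauchy_kernel z holomorphic_on \<Omega>s z - insert (z $ i) (Ks z)" by (rule cauchy_kernel_holomorphic) auto
  qed (use slices[of z] U1 U2 in auto)
  also have "\<dots> = cutoff_integral (Ks z) U1 (cauchy_kernel z) + cutoff_integral {z $ i} U2 (cauchy_kernel z)"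
    by (rule cutoff_integral_Un) (use slices[of z] U1 U2 in \<open>auto intro!: cauchy_kernel_holomorphic\<close>)
  also have "cutoff_integral (Ks z) U1 (cauchy_kernel z) = cutoff_integral (Ks z) (\<Omega>s z - {z $ i}) (cauchy_kernel z)"
    by (rule cutoff_integral_mono)
       (use slices[of z] U1 in \<open>auto intro!: cauchy_kernel_holomorphic open_Diff\<close>)
  also have "cutoff_integral {z $ i} U2 (cauchy_kernel z) = cauchy_const * f (upd i z (z $ i))"
    unfolding cauchy_kernel_def
    by (rule cutoff_integral_Cauchy[OF U2(1,2) holomorphic_on_subset[OF f_slice U2(3)]])
  finally show ?thesis
    using cauchy_const_nonzero by (simp add: ext_def jump_def upd_self add_divide_distrib)
qed

lemma jump_eq_0:
  assumes conn: "connected (- K)" and "i \<noteq> j" "z \<in> - K"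
  shows "jump z = 0"
proof -
  obtain R where R: "\<And>x. x \<in> K \<Longrightarrow> norm x \<le> R" using compact_imp_bounded[OF K(1)]
    by (auto simp: bounded_iff)
  \<comment> \<open>The second coordinate direction enters here: as \<open>j\<close> differs from
    \<open>i\<close>, changing coordinate \<open>i\<close> stays in \<open>A\<close>, so slices
    through points of \<open>A\<close> miss \<open>K\<close> altogether.\<close>
  define A where "A = {x :: complex^'n. R < norm (x $ j)}"
  have far: "x \<notin> K" if "x \<in> A" for x
    using that R Finite_Cartesian_Product.norm_nth_le[of x j] by (fastforce simp: A_def)
  show ?thesis
  proof (rule holo_on_identity_theorem[OF jump_holo _ conn])
    show "open (- K)" using compact_imp_closed[OF K(1)] by auto
    show "open A" unfolding A_def by (intro open_Collect_less continuous_intros)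
    \<comment> \<open>The absolute value covers a negative \<open>R\<close>, which the bound allows
      when \<open>K\<close> is empty.\<close>
    have "norm (complex_of_real (\<bar>R\<bar> + 1)) = \<bar>R\<bar> + 1" by (subst norm_of_real) simp
    then have "axis j (complex_of_real (\<bar>R\<bar> + 1)) \<in> A" by (simp add: A_def del: of_real_add)
    then show "A \<noteq> {}" by blast
    show "A \<subseteq> - K" using far by blast
    show "z \<in> - K" by fact
    fix x assume "x \<in> A"
    then have "upd i x \<zeta> \<in> A" for \<zeta> using \<open>i \<noteq> j\<close> by (simp add: A_def upd_nth)
    then have "Ks x = {}" using far by (auto simp: Ks_def)
    moreover have "cutoff_integral {} (\<Omega>s x - {x $ i}) (cauchy_kernel x) = 0"
      by (rule cutoff_integral_empty)
         (use slices[of x] \<open>Ks x = {}\<close> in \<open>auto intro!: cauchy_kernel_holomorphic open_Diff\<close>)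
    ultimately show "jump x = 0" by (simp add: jump_def)
  qed
qed

end

theorem Hartogs_extension:
  fixes \<Omega> K :: "(complex^'n) set"
  assumes "CARD('n) \<ge> 2" "open \<Omega>" "compact K" "K \<subseteq> \<Omega>" "connected (- K)" "holo_on (\<Omega> - K) f"
  obtains g where "holo_on \<Omega> g" "\<And>z. z \<in> \<Omega> - K \<Longrightarrow> g z = f z"
proof -
  obtain i j :: 'n where ij: "i \<noteq> j"
    using assms(1) card_le_Suc0_iff_eq[of "UNIV :: 'n set"] by fastforce
  interpret hartogs \<Omega> K f i by unfold_locales (use assms in auto)
  show thesis
  proof (rule that[OF ext_holo])
    fix z assume "z \<in> \<Omega> - K"
    then show "ext z = f z" using ext_eq jump_eq_0[OF assms(5) ij] by simp
  qed
qed

subsection \<open>The equivalences\<close>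

lemma loc_const_on_imp_holo_on:
  assumes "open U" "loc_const_on U g"
  shows "holo_on U g"
proof (rule holo_on_local)
  fix z assume z: "z \<in> U"
  then obtain e where e: "e > 0" "\<forall>w\<in>ball z e \<inter> U. g w = g z"
    using assms(2) unfolding loc_const_on_def by blast
  have "holo_on (ball z e \<inter> U) g"
    by (rule holo_on_transform[OF holo_on_const[of _ "g z"]]) (use assms(1) e in auto)
  then show "\<exists>B. z \<in> B \<and> holo_on B g" using z e(1) by (intro exI[of _ "ball z e \<inter> U"]) auto
qed

lemma holo_on_extension_unique:
  fixes g h :: "complex^'n \<Rightarrow> complex"
  assumes "open U" "compact K" "K \<subseteq> U" "holo_on U g" "holo_on U h"
    "\<And>z. z \<in> U - K \<Longrightarrow> h z = g z" "z \<in> U"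
  shows "h z = g z"
proof -
  have "h z - g z = 0"
    by (rule holo_on_eq_0_outside_compact[OF holo_on_diff[OF assms(5,4)] assms(1-3) _ assms(7)])
       (use assms(6) in simp)
  then show ?thesis by simp
qed

lemma restr_in_Hol:
  assumes "open V" "V \<subseteq> U" "holo_on U f"
  shows "restr V f \<in> Hol V"
proof -
  have "holo_on V (restr V f)"
    by (rule holo_on_transform[OF holo_on_subset[OF assms(3,2)] assms(1)]) (simp add: restr_def)
  then show ?thesis by (simp add: Hol_def restr_def)
qed

text \<open>Restriction commutes with the pointwise operations and, as \<open>V\<close> lies in
  \<open>U\<close>, preserves the unit, which leaves bijectivity.\<close>

lemma alg_iso_restr_iff:
  assumes "V \<subseteq> U"
  shows "alg_iso (restr V) U V \<longleftrightarrow> bij_betw (restr V) (Hol U) (Hol V)"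
  using assms by (auto simp: alg_iso_def restr_def fun_eq_iff)

text \<open>Injectivity always holds, by uniqueness of extensions and the convention that members of
  \<open>Hol\<close> are 0 off their domain; surjectivity is the extension property.\<close>

lemma alg_iso_restr_iff_extension:
  fixes \<Omega> K :: "(complex^'n) set"
  assumes "open \<Omega>" "compact K" "K \<subseteq> \<Omega>"
  shows "alg_iso (restr (\<Omega> - K)) \<Omega> (\<Omega> - K) \<longleftrightarrow>
    (\<forall>f. holo_on (\<Omega> - K) f \<longrightarrow> (\<exists>g. holo_on \<Omega> g \<and> (\<forall>z\<in>\<Omega> - K. g z = f z)))"
    (is "?iso \<longleftrightarrow> ?ext")
proof -
  have op: "open (\<Omega> - K)" using assms compact_imp_closed by blast
  have maps: "restr (\<Omega> - K) f \<in> Hol (\<Omega> - K)" if "holo_on \<Omega> f" for f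
    by (rule restr_in_Hol[OF op _ that]) auto
  have inj: "inj_on (restr (\<Omega> - K)) (Hol \<Omega>)"
  proof (rule inj_onI)
    fix f g assume f: "f \<in> Hol \<Omega>" and g: "g \<in> Hol \<Omega>" and eq: "restr (\<Omega> - K) f = restr (\<Omega> - K) g"
    have "f z = g z" if "z \<in> \<Omega> - K" for z using fun_cong[OF eq, of z] that by (simp add: restr_def)
    then have "f z = g z" if "z \<in> \<Omega>" for z
      using holo_on_extension_unique[OF assms, of g f z] f g that by (simp add: Hol_def)
    moreover have "f z = g z" if "z \<notin> \<Omega>" for z using f g that by (simp add: Hol_def)
    ultimately show "f = g" by blast
  qed
  show ?thesis
  proof
    assume ?iso
    then have surj: "restr (\<Omega> - K) ` Hol \<Omega> = Hol (\<Omega> - K)" by (simp add: alg_iso_def bij_betw_def)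
    show ?ext
    proof (intro allI impI)
      fix f assume "holo_on (\<Omega> - K) f"
      then have "restr (\<Omega> - K) f \<in> restr (\<Omega> - K) ` Hol \<Omega>"
        unfolding surj by (intro restr_in_Hol[OF op subset_refl])
      then obtain g where g: "g \<in> Hol \<Omega>" "restr (\<Omega> - K) f = restr (\<Omega> - K) g" by blast
      have "g z = f z" if "z \<in> \<Omega> - K" for z using fun_cong[OF g(2), of z] that by (simp add: restr_def)
      then show "\<exists>g. holo_on \<Omega> g \<and> (\<forall>z\<in>\<Omega> - K. g z = f z)" using g(1) by (auto simp: Hol_def)
    qed
  next
    assume ext: ?ext
    have "f \<in> restr (\<Omega> - K) ` Hol \<Omega>" if f: "f \<in> Hol (\<Omega> - K)" for f
    proof -
      obtain g where g: "holo_on \<Omega> g" "\<And>z. z \<in> \<Omega> - K \<Longrightarrow> g z = f z"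
        using ext f unfolding Hol_def by blast
      \<comment> \<open>The extension \<open>g\<close> is cut to 0 off \<open>\<Omega>\<close> to
        become a member of \<open>Hol \<Omega>\<close>.\<close>
      have "f = restr (\<Omega> - K) (restr \<Omega> g)"
        using f g(2) by (auto simp: restr_def Hol_def fun_eq_iff)
      then show ?thesis using restr_in_Hol[OF assms(1) subset_refl g(1)] by blast
    qed
    then have "restr (\<Omega> - K) ` Hol \<Omega> = Hol (\<Omega> - K)" using maps by (auto simp: Hol_def)
    then have "bij_betw (restr (\<Omega> - K)) (Hol \<Omega>) (Hol (\<Omega> - K))" using inj by (simp add: bij_betw_def)
    then show ?iso using alg_iso_restr_iff[of "\<Omega> - K" \<Omega>] by blast
  qed
qed

text \<open>If \<open>f a\<close> were not attained off \<open>K\<close>, then \<open>1 / (f - f a)\<close> would extend to \<open>\<Omega>\<close>.\<close>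

lemma image_eq_image_outside_compact:
  fixes \<Omega> K :: "(complex^'n) set"
  assumes "CARD('n) \<ge> 2" "open \<Omega>" "compact K" "K \<subseteq> \<Omega>" "connected (- K)" "holo_on \<Omega> f"
  shows "f ` \<Omega> = f ` (\<Omega> - K)"
proof -
  have "f a \<in> f ` (\<Omega> - K)" if a: "a \<in> \<Omega>" for a
  proof (rule ccontr)
    assume na: "f a \<notin> f ` (\<Omega> - K)"
    have hol: "holo_on \<Omega> (\<lambda>z. f z - f a)" by (intro holo_on_diff assms(6) holo_on_const)
    have nz: "f z - f a \<noteq> 0" if "z \<in> \<Omega> - K" for z using na that by (metis image_eqI right_minus_eq)
    have inv: "holo_on (\<Omega> - K) (\<lambda>z. inverse (f z - f a))"
      by (rule holo_on_inverse[OF holo_on_subset[OF hol] nz]) auto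
    obtain g where g: "holo_on \<Omega> g" "\<And>z. z \<in> \<Omega> - K \<Longrightarrow> g z = inverse (f z - f a)"
      using Hartogs_extension[OF assms(1-5) inv] by blast
    \<comment> \<open>The product of \<open>g\<close> and \<open>f - f a\<close> is 1 off
      \<open>K\<close>, hence on all of \<open>\<Omega>\<close>; at \<open>a\<close> this is
      absurd.\<close>
    have "g a * (f a - f a) = 1"
    proof (rule holo_on_extension_unique[OF assms(2-4), where g = "\<lambda>_. 1"
        and h = "\<lambda>z. g z * (f z - f a)" and z = a])
      show "holo_on \<Omega> (\<lambda>_. 1)" by (rule holo_on_const)
      show "holo_on \<Omega> (\<lambda>z. g z * (f z - f a))" by (rule holo_on_mult[OF g(1) hol])
    qed (use g(2) nz a in auto)
    then show False by simp
  qed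
  then show ?thesis by auto
qed

theorem mainTheorem3:
  fixes \<Omega> K :: "(complex^'n) set"
  assumes "CARD('n) \<ge> 2" and "open \<Omega>" and "compact K" and "K \<subseteq> \<Omega>"
  defines "P1 \<equiv> (\<forall>f. holo_on (\<Omega> - K) f \<longrightarrow>
              (\<exists>g. holo_on \<Omega> g \<and> (\<forall>z\<in>\<Omega> - K. g z = f z) \<and>
                   (\<forall>h. holo_on \<Omega> h \<and> (\<forall>z\<in>\<Omega> - K. h z = f z) \<longrightarrow> (\<forall>z\<in>\<Omega>. h z = g z))))"
      and "P1' \<equiv> (\<forall>g. loc_const_on (\<Omega> - K) g \<longrightarrow>
              (\<exists>g'. holo_on \<Omega> g' \<and> (\<forall>z\<in>\<Omega> - K. g' z = g z)))"
      and "P2 \<equiv> alg_iso (restr (\<Omega> - K)) \<Omega> (\<Omega> - K)"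
      and "P3 \<equiv> connected (- K)"
  shows "(P1 \<longleftrightarrow> P1') \<and> (P1' \<longleftrightarrow> P2) \<and> (P2 \<longleftrightarrow> P3) \<and>
         (P3 \<longrightarrow> (\<forall>f. holo_on \<Omega> f \<longrightarrow> f ` \<Omega> = f ` (\<Omega> - K)))"
proof -
  \<comment> \<open>Existence of extensions without the uniqueness clause is the hub:
    \<open>P1\<close> and \<open>P2\<close> are each equivalent to \<open>E\<close>, and
    \<open>E\<close>, \<open>P1'\<close>, \<open>P3\<close> imply one another in a cycle.\<close>
  define E where "E \<longleftrightarrow>
    (\<forall>f. holo_on (\<Omega> - K) f \<longrightarrow> (\<exists>g. holo_on \<Omega> g \<and> (\<forall>z\<in>\<Omega> - K. g z = f z)))"
  have op: "open (\<Omega> - K)" using assms(2,3) compact_imp_closed by blast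
  have "P1 \<longleftrightarrow> E"
  proof
    assume P1
    then show E unfolding P1_def E_def by blast
  next
    assume E: E
    show P1
      unfolding P1_def
    proof (intro allI impI)
      fix f assume "holo_on (\<Omega> - K) f"
      then obtain g where g: "holo_on \<Omega> g" "\<forall>z\<in>\<Omega> - K. g z = f z" using E unfolding E_def by blast
      have "h z = g z" if "holo_on \<Omega> h" "\<forall>z\<in>\<Omega> - K. h z = f z" "z \<in> \<Omega>" for h z
        by (rule holo_on_extension_unique[OF assms(2-4) g(1) that(1) _ that(3)]) (use g(2) that(2) in simp)
      then show "\<exists>g. holo_on \<Omega> g \<and> (\<forall>z\<in>\<Omega> - K. g z = f z) \<and>
          (\<forall>h. holo_on \<Omega> h \<and> (\<forall>z\<in>\<Omega> - K. h z = f z) \<longrightarrow> (\<forall>z\<in>\<Omega>. h z = g z))"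
        using g by blast
    qed
  qed
  moreover have "P2 \<longleftrightarrow> E"
    unfolding P2_def E_def by (rule alg_iso_restr_iff_extension[OF assms(2-4)])
  moreover have "E \<Longrightarrow> P1'"
    unfolding E_def P1'_def using loc_const_on_imp_holo_on[OF op] by blast
  moreover have "P1' \<Longrightarrow> P3"
    unfolding P1'_def P3_def using bounded_component_obstruction[OF assms(2-4)] by blast
  moreover have E if P3
    unfolding E_def
  proof (intro allI impI)
    fix f assume "holo_on (\<Omega> - K) f"
    then show "\<exists>g. holo_on \<Omega> g \<and> (\<forall>z\<in>\<Omega> - K. g z = f z)"
      by (rule Hartogs_extension[OF assms(1-4) that[unfolded P3_def]]) blast
  qed
  moreover have "\<forall>f. holo_on \<Omega> f \<longrightarrow> f ` \<Omega> = f ` (\<Omega> - K)" if P3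
    by (intro allI impI image_eq_image_outside_compact assms(1-4) that[unfolded P3_def])
  ultimately show ?thesis by blast
qed

end
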